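(* There exists a function $\mathrm{A}:2^{<\omega}\to\mathbb{N}$ satisfying all of the following: (1) $\mathrm{A}$ is upper semi-computable; (2) for every partial computable function $f:2^{<\omega}\to 2^{<\omega}$ there exists a constant $c_f$ such that $\mathrm{A}(f(x))\le \mathrm{A}(x)+c_f$ for every $x$ in the domain of $f$; (3) $\sum_{x\in 2^{<\omega}} 2^{-\mathrm{A}(x)}<\infty$; (4) there is a constant $c$ such that $\mathrm{A}(x)\le |x|+\mathrm{A}(|x|)+c$ for every $x\in 2^{<\omega}$ (where the number $|x|$ is identified with a string); (5) there is a constant $c'$ such that for all $n,b\in\mathbb{N}$, $\left|\{x\in 2^{<\omega} : |x|=n,\ \mathrm{A}(x)\le n+\mathrm{A}(n)-b\}\right|\le c'\cdot 2^{n-b}$; (6) $|\mathrm{A}(x)-\mathrm{K}(x)|$ is unbounded as $x$ ranges over $2^{<\omega}$.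
   Context: $2^{<\omega}$ denotes the set of finite binary strings, identified with natural numbers in the standard way; $|x|$ is the length of $x$. A function $\mathrm{A}:2^{<\omega}\to\mathbb{N}$ is upper semi-computable if the predicate "$\mathrm{A}(x)\le k$" is computably enumerable uniformly in $x,k$. For a machine $T$, $\mathrm{C}_T(x)=\min\{|y| : T(y)=x\}$. A prefix-free machine is one whose domain is prefix-free; fix an optimal prefix-free machine $\mathbb{U}'$ (for every prefix-free machine $T$ there is $c_T$ with $\mathrm{C}_{\mathbb{U}'}\le \mathrm{C}_T+c_T$) and let $\mathrm{K}=\mathrm{C}_{\mathbb{U}'}$ be prefix-free Kolmogorov complexity. *)

theory Defs
  imports "HOL-Analysis.Analysis"
begin

datatype recf = Z | S | Proj nat | Comp recf "recf list" | Prec recf recf | Mn recf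

inductive eval :: "recf \<Rightarrow> nat list \<Rightarrow> nat \<Rightarrow> bool" where
  eval_Z: "eval Z xs 0"
| eval_S: "eval S (x # xs) (Suc x)"
| eval_Proj: "i < length xs \<Longrightarrow> eval (Proj i) xs (xs ! i)"
| eval_Comp: "list_all2 (\<lambda>g y. eval g xs y) gs ys \<Longrightarrow> eval f ys z \<Longrightarrow> eval (Comp f gs) xs z"
| eval_Prec0: "eval f xs z \<Longrightarrow> eval (Prec f g) (0 # xs) z"
| eval_PrecS: "eval (Prec f g) (n # xs) y \<Longrightarrow> eval g (y # n # xs) z
               \<Longrightarrow> eval (Prec f g) (Suc n # xs) z"
| eval_Mn: "eval f (n # xs) 0 \<Longrightarrow> (\<forall>m<n. \<exists>y. eval f (m # xs) (Suc y))
               \<Longrightarrow> eval (Mn f) xs n"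

definition partial_computable :: "(nat \<Rightarrow> nat option) \<Rightarrow> bool" where
  "partial_computable f \<longleftrightarrow> (\<exists>e. \<forall>x y. f x = Some y \<longleftrightarrow> eval e [x] y)"

definition ce_pred2 :: "(nat \<Rightarrow> nat \<Rightarrow> bool) \<Rightarrow> bool" where
  "ce_pred2 P \<longleftrightarrow> (\<exists>e. \<forall>x k. P x k \<longleftrightarrow> (\<exists>y. eval e [x, k] y))"

type_synonym str = "bool list"

text \<open>Standard bijection: the string s corresponds to (binary value of 1s) - 1.\<close>
definition nat_of_str :: "str \<Rightarrow> nat" where
  "nat_of_str s = foldl (\<lambda>a b. 2 * a + (if b then 1 else 0)) 1 s - 1"

fun bits :: "nat \<Rightarrow> str" where
  "bits m = (if m \<le> 1 then [] else bits (m div 2) @ [odd m])"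

definition str_of_nat :: "nat \<Rightarrow> str" where
  "str_of_nat n = bits (n + 1)"

definition pc_str :: "(str \<Rightarrow> str option) \<Rightarrow> bool" where
  "pc_str f \<longleftrightarrow> partial_computable (\<lambda>n. map_option nat_of_str (f (str_of_nat n)))"

definition upper_semicomputable :: "(str \<Rightarrow> nat) \<Rightarrow> bool" where
  "upper_semicomputable A \<longleftrightarrow> ce_pred2 (\<lambda>x k. A (str_of_nat x) \<le> k)"

definition C_mach :: "(str \<Rightarrow> str option) \<Rightarrow> str \<Rightarrow> enat" where
  "C_mach T x = Inf ((\<lambda>y. enat (length y)) ` {y. T y = Some x})"

definition prefix_free_machine :: "(str \<Rightarrow> str option) \<Rightarrow> bool" where
  "prefix_free_machine T \<longleftrightarrow> pc_str T \<and>
     (\<forall>y z w. T y \<noteq> None \<longrightarrow> T z \<noteq> None \<longrightarrow> z = y @ w \<longrightarrow> y = z)"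

definition optimal_pf_machine :: "(str \<Rightarrow> str option) \<Rightarrow> bool" where
  "optimal_pf_machine U \<longleftrightarrow> prefix_free_machine U \<and>
     (\<forall>T. prefix_free_machine T \<longrightarrow> (\<exists>c::nat. \<forall>x. C_mach U x \<le> C_mach T x + enat c))"

end

theory Submission
  imports Defs "HOL-Library.Nat_Bijection"
begin

text \<open>Consider processes that start at the number 0 and proceed by two kinds of steps: apply a partial
  computable function, or read a block of \<open>v\<close> random bits, where \<open>v\<close> is the current number, and continue
  with the block as the new value. Each step is paid for with a fixed penalty and each bit with cost 1;
  \<open>2 ^ - A x\<close> is, up to a factor 2, the total weight of the processes that end at \<open>x\<close>. The two kinds of steps
  give (2) and (4), the total weight is finite because the penalties form a geometric series, and
  applying the length function to all processes ending in strings of length \<open>n\<close> gives (5).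

  Unlike a prefix-free machine, such a process must announce the length of a block before reading it.
  This makes it defeatable: only finitely many processes have few (or cheap) steps, and the other ones
  have small total weight. A prefix-free machine gives code words of length \<open>l\<close> to 0, 1, 2, ... in turn,
  waiting each time until \<open>A\<close> has caught up, and increases \<open>l\<close> by one whenever a cheap process was used to
  catch up. This happens finitely often and costs a geometric series, while every other answer
  spends an amount proportional to \<open>2 ^ - l\<close> of the small weight of the expensive processes; so \<open>A\<close>
  eventually stays behind.\<close>

section \<open>Computable functions and enumerable predicates\<close>

lemma eval_functional:
  assumes "eval e xs y" "eval e xs z"
  shows "y = z"
  using assms
proof (induction arbitrary: z rule: eval.induct)
  case (eval_Z xs)
  then show ?case by (auto elim: eval.cases)
next
  case (eval_S x xs)
  then show ?case by (auto elim: eval.cases)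
next
  case (eval_Proj i xs)
  then show ?case by (auto elim: eval.cases)
next
  case (eval_Comp xs gs ys f y)
  from eval_Comp.prems obtain ys' where ys': "list_all2 (\<lambda>g y. eval g xs y) gs ys'" "eval f ys' z"
    by (auto elim: eval.cases)
  have "ys = ys'"
    using eval_Comp.IH(1) ys'(1)
    by (simp add: list_all2_conv_all_nth list_eq_iff_nth_eq)
  then show ?case using eval_Comp.IH(2) ys'(2) by simp
next
  case (eval_Prec0 f xs z' g)
  from eval_Prec0.prems have "eval f xs z" by (cases rule: eval.cases) auto
  then show ?case using eval_Prec0.IH by simp
next
  case (eval_PrecS f g n xs y z')
  from eval_PrecS.prems obtain y' where "eval (Prec f g) (n # xs) y'" "eval g (y' # n # xs) z"
    by (cases rule: eval.cases) auto
  then show ?case using eval_PrecS.IH by blast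
next
  case (eval_Mn f n xs)
  from eval_Mn.prems have z: "eval f (z # xs) 0" "\<forall>m<z. \<exists>y. eval f (m # xs) (Suc y)"
    by (cases rule: eval.cases; auto)+
  show ?case
  \<comment> \<open>If one search stopped earlier, its stopping point would have the value 0 and,
    for the other search, a successor value.\<close>
  proof (rule linorder_cases[of n z])
    assume "n < z"
    then show ?thesis using z(2) eval_Mn.IH(1) by fastforce
  next
    assume "z < n"
    then obtain y where "\<forall>w. eval f (z # xs) w \<longrightarrow> Suc y = w"
      using eval_Mn.IH(2) by blast
    then show ?thesis using z(1) by fastforce
  qed simp
qed

section \<open>Total computable functions of a fixed arity\<close>

definition computable :: "nat \<Rightarrow> (nat list \<Rightarrow> nat) \<Rightarrow> bool" where
  "computable n F \<longleftrightarrow> (\<exists>e. \<forall>xs. length xs = n \<longrightarrow> eval e xs (F xs))"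

lemma computable_nth: "i < n \<Longrightarrow> computable n (\<lambda>xs. xs ! i)"
  unfolding computable_def using eval_Proj by metis

lemma computable_comp:
  assumes "computable (length Gs) F" "\<And>G. G \<in> set Gs \<Longrightarrow> computable n G"
  shows "computable n (\<lambda>xs. F (map (\<lambda>G. G xs) Gs))"
proof -
  obtain f where f: "\<And>xs. length xs = length Gs \<Longrightarrow> eval f xs (F xs)"
    using assms(1) unfolding computable_def by blast
  obtain g where g: "\<And>G xs. G \<in> set Gs \<Longrightarrow> length xs = n \<Longrightarrow> eval (g G) xs (G xs)"
    using assms(2) unfolding computable_def by metis
  have "eval (Comp f (map g Gs)) xs (F (map (\<lambda>G. G xs) Gs))" if "length xs = n" for xs
    by (rule eval_Comp[of _ _ "map (\<lambda>G. G xs) Gs"])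
       (auto simp: list_all2_conv_all_nth f g that)
  then show ?thesis unfolding computable_def by blast
qed

lemma computable_comp1:
  assumes "computable 1 (\<lambda>xs. f (xs ! 0))" "computable n G"
  shows "computable n (\<lambda>xs. f (G xs))"
  using computable_comp[of "[G]" "\<lambda>xs. f (xs ! 0)" n] assms by simp

lemma computable_comp2:
  assumes "computable 2 (\<lambda>xs. f (xs ! 0) (xs ! 1))" "computable n G" "computable n H"
  shows "computable n (\<lambda>xs. f (G xs) (H xs))"
  using computable_comp[of "[G, H]" "\<lambda>xs. f (xs ! 0) (xs ! 1)" n] assms
  by (auto simp: numeral_2_eq_2)

lemma computable_Suc: "computable n G \<Longrightarrow> computable n (\<lambda>xs. Suc (G xs))"
  by (rule computable_comp1[where f = Suc])
     (auto simp: computable_def length_Suc_conv intro!: exI[of _ S] eval_S)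

lemma computable_const: "computable n (\<lambda>_. c)"
proof (induction c)
  case 0
  then show ?case unfolding computable_def using eval_Z by blast
qed (rule computable_Suc)

text \<open>One parameter is enough, since several can be packed into one number by pairing.
  \<open>Prec\<close> supplies the previous value before the counter, hence the permuted step
  function in the proof.\<close>

lemma computable_rec:
  assumes "computable 1 (\<lambda>xs. a (xs ! 0))" "computable 3 (\<lambda>xs. g (xs ! 0) (xs ! 1) (xs ! 2))"
  shows "computable 2 (\<lambda>xs. rec_nat (a (xs ! 1)) (\<lambda>k r. g k r (xs ! 1)) (xs ! 0))"
proof -
  obtain f where f: "\<And>x. eval f [x] (a x)"
    using assms(1) unfolding computable_def by (metis One_nat_def length_Cons list.size(3) nth_Cons_0)
  have "computable 3 (\<lambda>xs. g (xs ! 1) (xs ! 0) (xs ! 2))"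
    using computable_comp[of "[\<lambda>xs. xs ! 1, \<lambda>xs. xs ! 0, \<lambda>xs. xs ! 2]"
        "\<lambda>xs. g (xs ! 0) (xs ! 1) (xs ! 2)" 3] assms(2)
    by (auto simp: numeral_3_eq_3 numeral_2_eq_2 intro!: computable_nth)
  then obtain h where h: "\<And>xs. length xs = 3 \<Longrightarrow> eval h xs (g (xs ! 1) (xs ! 0) (xs ! 2))"
    unfolding computable_def by blast
  have "eval h [r, k, x] (g k r x)" for r k x
    using h[of "[r, k, x]"] by (simp add: numeral_2_eq_2)
  then have "eval (Prec f h) [n, x] (rec_nat (a x) (\<lambda>k r. g k r x) n)" for n x
    by (induction n) (auto intro: eval_Prec0 eval_PrecS f)
  then show ?thesis
    unfolding computable_def by (auto simp: numeral_2_eq_2 length_Suc_conv intro!: exI[of _ "Prec f h"])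
qed

lemma computable_plus: "computable 2 (\<lambda>xs. xs ! 0 + xs ! 1)"
proof -
  have "rec_nat y (\<lambda>k r. Suc r) x = x + y" for x y by (induction x) auto
  then show ?thesis
    using computable_rec[of "\<lambda>x. x" "\<lambda>k r x. Suc r"] by (simp add: computable_nth computable_Suc)
qed

lemma computable_times: "computable 2 (\<lambda>xs. xs ! 0 * xs ! 1)"
proof -
  have *: "rec_nat 0 (\<lambda>k r. r + y) x = x * y" for x y by (induction x) auto
  have "computable 3 (\<lambda>xs. xs ! 1 + xs ! 2)"
    by (rule computable_comp2[OF computable_plus]) (simp_all add: computable_nth)
  then show ?thesis
    using computable_rec[of "\<lambda>x. 0" "\<lambda>k r x. r + x"] by (simp add: computable_const *)
qed

lemma computable_minus: "computable 2 (\<lambda>xs. xs ! 0 - xs ! 1)"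
proof -
  have p: "computable 1 (\<lambda>xs. xs ! 0 - 1)"
  proof -
    have *: "rec_nat 0 (\<lambda>k r. k) n = n - 1" for n by (cases n) auto
    have "computable 2 (\<lambda>xs. xs ! 0 - 1)"
      using computable_rec[of "\<lambda>x. 0" "\<lambda>k r x. k"] by (simp add: computable_nth computable_const *)
    then show ?thesis
      by (rule computable_comp2[where f = "\<lambda>x y. x - 1" and H = "\<lambda>_. 0"])
         (simp_all add: computable_nth computable_const)
  qed
  have *: "rec_nat y (\<lambda>k r. r - Suc 0) x = y - x" for x y :: nat by (induction x) auto
  have "computable 3 (\<lambda>xs. xs ! 1 - 1)"
    by (rule computable_comp1[OF p]) (simp add: computable_nth)
  then have "computable 2 (\<lambda>xs. xs ! 1 - xs ! 0)"
    using computable_rec[of "\<lambda>x. x" "\<lambda>k r x. r - 1"] by (simp add: computable_nth *)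
  from computable_comp2[where f = "\<lambda>x y. y - x", OF this computable_nth[of 1] computable_nth[of 0]]
  show ?thesis by simp
qed

section \<open>Unary computable functions, to which the other ones are reduced by pairing\<close>

definition cf :: "(nat \<Rightarrow> nat) \<Rightarrow> bool" where
  "cf f \<longleftrightarrow> (\<exists>e. \<forall>x. eval e [x] (f x))"

lemma cf_iff: "cf f \<longleftrightarrow> computable 1 (\<lambda>xs. f (xs ! 0))"
proof -
  have "(\<forall>xs. length xs = 1 \<longrightarrow> eval e xs (f (xs ! 0))) \<longleftrightarrow> (\<forall>x. eval e [x] (f x))" for e
    by (auto simp: length_Suc_conv)
  then show ?thesis unfolding cf_def computable_def by simp
qed

named_theorems cf_intros

lemma cf_comp: "cf f \<Longrightarrow> cf g \<Longrightarrow> cf (\<lambda>x. f (g x))"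
  unfolding cf_iff by (rule computable_comp1)

lemma cf_comp2:
  "computable 2 (\<lambda>xs. f (xs ! 0) (xs ! 1)) \<Longrightarrow> cf g \<Longrightarrow> cf h \<Longrightarrow> cf (\<lambda>x. f (g x) (h x))"
  unfolding cf_iff by (rule computable_comp2)

lemma cf_const [cf_intros]: "cf (\<lambda>_. c)"
  unfolding cf_iff by (rule computable_const)

lemma cf_id [cf_intros]: "cf (\<lambda>x. x)"
  unfolding cf_iff by (simp add: computable_nth)

lemma cf_Suc [cf_intros]: "cf f \<Longrightarrow> cf (\<lambda>x. Suc (f x))"
  unfolding cf_iff by (rule computable_Suc)

lemmas cf_plus [cf_intros] = cf_comp2[where f = "\<lambda>x y. x + y", OF computable_plus]
lemmas cf_times [cf_intros] = cf_comp2[where f = "\<lambda>x y. x * y", OF computable_times]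
lemmas cf_minus [cf_intros] = cf_comp2[where f = "\<lambda>x y. x - y", OF computable_minus]

section \<open>The Cantor pairing and the computability of its projections\<close>

definition npair :: "nat \<Rightarrow> nat \<Rightarrow> nat" where "npair x y = prod_encode (x, y)"
definition pfst :: "nat \<Rightarrow> nat" where "pfst z = fst (prod_decode z)"
definition psnd :: "nat \<Rightarrow> nat" where "psnd z = snd (prod_decode z)"

lemma pfst_npair [simp]: "pfst (npair x y) = x"
  and psnd_npair [simp]: "psnd (npair x y) = y"
  and npair_eq_iff [simp]: "npair x y = npair x' y' \<longleftrightarrow> x = x' \<and> y = y'"
  and npair_surj [simp]: "npair (pfst z) (psnd z) = z"
  by (simp_all add: npair_def pfst_def psnd_def prod_encode_eq)

lemma ex_npair_iff: "(\<exists>s. P (pfst s) (psnd s)) \<longleftrightarrow> (\<exists>x y. P x y)"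
proof
  assume "\<exists>x y. P x y"
  then obtain x y where "P (pfst (npair x y)) (psnd (npair x y))" by auto
  then show "\<exists>s. P (pfst s) (psnd s)" by blast
qed blast

lemma triangle_eq_rec: "triangle n = rec_nat 0 (\<lambda>k r. r + Suc k) n"
  by (induction n) auto

lemma cf_rec0:
  assumes "computable 2 (\<lambda>xs. g (xs ! 0) (xs ! 1))"
  shows "cf (rec_nat a g)"
proof -
  have "computable 3 (\<lambda>xs. g (xs ! 0) (xs ! 1))"
    by (rule computable_comp2[OF assms]) (simp_all add: computable_nth)
  then have "computable 2 (\<lambda>xs. rec_nat a g (xs ! 0))"
    using computable_rec[of "\<lambda>x. a" "\<lambda>k r x. g k r"] by (simp add: computable_const)
  from cf_comp2[where f = "\<lambda>x y. rec_nat a g x", OF this cf_id cf_id] show ?thesis .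
qed

lemma cf_triangle: "cf triangle"
proof -
  have "computable 2 (\<lambda>xs. xs ! 1 + Suc (xs ! 0))"
    by (intro computable_comp2[OF computable_plus] computable_Suc computable_nth) simp_all
  from cf_rec0[OF this, of 0] show ?thesis
    by (simp add: triangle_eq_rec[abs_def])
qed

lemma computable_npair: "computable 2 (\<lambda>xs. npair (xs ! 0) (xs ! 1))"
  unfolding npair_def prod_encode_def prod.case
  by (intro computable_comp2[OF computable_plus] computable_nth
      computable_comp1[OF cf_triangle[unfolded cf_iff]]) simp_all

lemma cf_npair [cf_intros]: "cf f \<Longrightarrow> cf g \<Longrightarrow> cf (\<lambda>x. npair (f x) (g x))"
  unfolding npair_def prod_encode_def by (auto intro!: cf_intros cf_comp[OF cf_triangle])

text \<open>The index of the diagonal of the Cantor pairing on which a number lies.\<close>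
definition diagonal :: "nat \<Rightarrow> nat" where
  "diagonal = rec_nat 0 (\<lambda>k r. r + (1 - (triangle (Suc r) - Suc k)))"

text \<open>By truncated subtraction the increment in \<open>diagonal\<close> is 1 if
  \<open>triangle (Suc r) \<le> Suc k\<close> and 0 otherwise, so the index moves on exactly when
  the next triangular number is reached.\<close>

lemma diagonal_bounds: "triangle (diagonal n) \<le> n \<and> n < triangle (Suc (diagonal n))"
proof (induction n)
  case (Suc n)
  define d where "d = diagonal n"
  have d: "diagonal (Suc n) = d + (1 - (triangle (Suc d) - Suc n))"
    unfolding d_def by (simp add: diagonal_def)
  show ?case
  proof (cases "triangle (Suc d) = Suc n")
    case True
    then have "diagonal (Suc n) = Suc d" using d by simp
    then show ?thesis using True by simp
  next
    case False
    then have "Suc n < triangle (Suc d)" using Suc.IH by (simp add: d_def)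
    then have "diagonal (Suc n) = d" using d by simp
    then show ?thesis using \<open>Suc n < triangle (Suc d)\<close> Suc.IH by (simp add: d_def)
  qed
qed (simp add: diagonal_def)

text \<open>As \<open>triangle\<close> is monotone, the bounds determine the index. Both projections
  can then be expressed by \<open>triangle\<close> and \<open>diagonal\<close>, which makes them
  computable.\<close>

lemma diagonal_eq: "diagonal z = pfst z + psnd z"
proof -
  define s where "s = pfst z + psnd z"
  have z: "z = triangle s + pfst z"
    using npair_surj[of z] by (simp add: s_def npair_def prod_encode_def)
  have "triangle s \<le> z" "z < triangle (Suc s)"
    using z s_def by simp_all
  moreover have "triangle a \<le> triangle b" if "a \<le> b" for a b
    using that by (induction rule: dec_induct) auto
  ultimately have "diagonal z = s"
  proof -
    assume mono: "\<And>a b. a \<le> b \<Longrightarrow> triangle a \<le> triangle b"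
      and s: "triangle s \<le> z" "z < triangle (Suc s)"
    show ?thesis
    proof (rule linorder_cases[of "diagonal z" s])
      assume "diagonal z < s"
      then show ?thesis using mono[of "Suc (diagonal z)" s] s diagonal_bounds[of z] by linarith
    next
      assume "s < diagonal z"
      then show ?thesis using mono[of "Suc s" "diagonal z"] s diagonal_bounds[of z] by linarith
    qed
  qed
  then show ?thesis by (simp add: s_def)
qed

lemma cf_diagonal: "cf diagonal"
proof -
  have "computable 2 (\<lambda>xs. triangle (Suc (xs ! 1)) - Suc (xs ! 0))"
    by (rule computable_comp2[OF computable_minus]; intro computable_Suc computable_nth
        computable_comp1[OF cf_triangle[unfolded cf_iff]]; simp)
  then have "computable 2 (\<lambda>xs. xs ! 1 + (1 - (triangle (Suc (xs ! 1)) - Suc (xs ! 0))))"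
    by (intro computable_comp2[OF computable_plus] computable_nth computable_const
        computable_comp2[OF computable_minus, of _ "\<lambda>_. 1"]) simp_all
  from cf_rec0[where g = "\<lambda>k r. r + (1 - (triangle (Suc r) - Suc k))", OF this, of 0]
  show ?thesis unfolding diagonal_def .
qed

lemma cf_pfst [cf_intros]: "cf f \<Longrightarrow> cf (\<lambda>x. pfst (f x))"
proof (rule cf_comp[where f = pfst])
  have "pfst = (\<lambda>z. z - triangle (diagonal z))"
  proof
    fix z
    show "pfst z = z - triangle (diagonal z)"
      using npair_surj[of z] by (simp add: diagonal_eq npair_def prod_encode_def)
  qed
  then show "cf pfst"
    using cf_minus[OF cf_id cf_comp[OF cf_triangle cf_diagonal]] by simp
qed

lemma cf_psnd [cf_intros]: "cf f \<Longrightarrow> cf (\<lambda>x. psnd (f x))"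
proof (rule cf_comp[where f = psnd])
  have "psnd = (\<lambda>z. diagonal z - pfst z)" by (simp add: diagonal_eq)
  then show "cf psnd"
    using cf_minus[OF cf_diagonal cf_pfst[OF cf_id]] by simp
qed

lemma cf_rec [cf_intros]:
  assumes "cf (\<lambda>z. g (pfst z) (pfst (psnd z)) (psnd (psnd z)))" "cf a" "cf n"
  shows "cf (\<lambda>x. rec_nat (a x) (\<lambda>k r. g k r x) (n x))"
proof -
  note np = computable_comp2[OF computable_npair]
  have "computable 3 (\<lambda>xs. g (xs ! 0) (xs ! 1) (xs ! 2))"
    using computable_comp1[OF assms(1)[unfolded cf_iff] np[OF _ np], of 3 "\<lambda>xs. xs ! 0" "\<lambda>xs. xs ! 1" "\<lambda>xs. xs ! 2"]
    by (simp add: computable_nth)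
  from computable_rec[OF assms(2)[unfolded cf_iff] this]
  have "computable 2 (\<lambda>xs. rec_nat (a (xs ! 1)) (\<lambda>k r. g k r (xs ! 1)) (xs ! 0))" .
  from cf_comp2[where f = "\<lambda>n x. rec_nat (a x) (\<lambda>k r. g k r x) n", OF this assms(3) cf_id]
  show ?thesis by simp
qed

section \<open>Decidable predicates\<close>

definition dec :: "(nat \<Rightarrow> bool) \<Rightarrow> bool" where
  "dec P \<longleftrightarrow> cf (\<lambda>x. of_bool (P x))"

lemma dec_comp: "dec P \<Longrightarrow> cf f \<Longrightarrow> dec (\<lambda>x. P (f x))"
  unfolding dec_def by (rule cf_comp)

lemma dec_le [cf_intros]: "cf f \<Longrightarrow> cf g \<Longrightarrow> dec (\<lambda>x. f x \<le> g x)"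
proof -
  have "of_bool (a \<le> b) = 1 - (a - b)" for a b :: nat by auto
  then show "cf f \<Longrightarrow> cf g \<Longrightarrow> ?thesis" unfolding dec_def by (simp add: cf_intros)
qed

lemma dec_not [cf_intros]: "dec P \<Longrightarrow> dec (\<lambda>x. \<not> P x)"
proof -
  have "of_bool (\<not> b) = (1 - of_bool b :: nat)" for b by simp
  then show "dec P \<Longrightarrow> ?thesis" unfolding dec_def by (simp only: cf_intros)
qed

lemma dec_conj [cf_intros]: "dec P \<Longrightarrow> dec Q \<Longrightarrow> dec (\<lambda>x. P x \<and> Q x)"
  unfolding dec_def of_bool_conj by (intro cf_intros)

lemma dec_less [cf_intros]: "cf f \<Longrightarrow> cf g \<Longrightarrow> dec (\<lambda>x. f x < g x)"
  unfolding not_le[symmetric] by (intro cf_intros)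

lemma dec_disj [cf_intros]: "dec P \<Longrightarrow> dec Q \<Longrightarrow> dec (\<lambda>x. P x \<or> Q x)"
  using dec_not[OF dec_conj[OF dec_not dec_not], of P Q] by simp

lemma dec_eq [cf_intros]: "cf f \<Longrightarrow> cf g \<Longrightarrow> dec (\<lambda>x. f x = g x)"
  unfolding eq_iff by (intro cf_intros)

lemma dec_ball [cf_intros]:
  assumes "dec (\<lambda>z. P (pfst z) (psnd z))" "cf n"
  shows "dec (\<lambda>x. \<forall>i<n x. P i x)"
proof -
  have "rec_nat 1 (\<lambda>i r. r * of_bool (P i x)) n = (of_bool (\<forall>i<n. P i x) :: nat)" for x n
    by (induction n) (auto simp: less_Suc_eq)
  moreover have "cf (\<lambda>x. rec_nat 1 (\<lambda>i r. r * of_bool (P i x)) (n x))"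
    using dec_comp[OF assms(1), of "\<lambda>z. npair (pfst z) (psnd (psnd z))"]
    by (intro cf_intros assms(2)) (simp add: dec_def cf_intros)
  ultimately show ?thesis by (simp add: dec_def)
qed

section \<open>Enumerable predicates as projections of decidable ones\<close>

definition re :: "(nat \<Rightarrow> bool) \<Rightarrow> bool" where
  "re P \<longleftrightarrow> (\<exists>R. dec R \<and> (\<forall>x. P x \<longleftrightarrow> (\<exists>t. R (npair t x))))"

named_theorems re_intros

lemma re_dec:
  assumes "dec P"
  shows "re P"
  unfolding re_def
  by (rule exI[of _ "\<lambda>z. P (psnd z)"]) (use dec_comp[OF assms cf_psnd[OF cf_id]] in simp)

lemmas re_eq [re_intros] = dec_eq[THEN re_dec]
lemmas re_le [re_intros] = dec_le[THEN re_dec]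
lemmas re_less [re_intros] = dec_less[THEN re_dec]

lemma re_comp:
  assumes "re P" "cf f"
  shows "re (\<lambda>x. P (f x))"
proof -
  obtain R where R: "dec R" "\<And>x. P x \<longleftrightarrow> (\<exists>t. R (npair t x))"
    using assms(1) unfolding re_def by blast
  show ?thesis unfolding re_def
    by (rule exI[of _ "\<lambda>z. R (npair (pfst z) (f (psnd z)))"])
       (simp add: R(2) dec_comp[OF R(1)] cf_intros cf_comp[OF assms(2)])
qed

lemma re_ex [re_intros]:
  assumes "re (\<lambda>z. P (pfst z) (psnd z))"
  shows "re (\<lambda>x. \<exists>y. P y x)"
proof -
  obtain R where R: "dec R" "\<And>x. P (pfst x) (psnd x) \<longleftrightarrow> (\<exists>t. R (npair t x))"
    using assms unfolding re_def by blast
  have "P y x \<longleftrightarrow> (\<exists>t. R (npair t (npair y x)))" for x y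
    using R(2)[of "npair y x"] by simp
  then have "(\<exists>y. P y x) \<longleftrightarrow> (\<exists>s. R (npair (pfst s) (npair (psnd s) x)))" for x
    using ex_npair_iff[of "\<lambda>t y. R (npair t (npair y x))" for x] by blast
  then show ?thesis unfolding re_def
    by (intro exI[of _ "\<lambda>z. R (npair (pfst (pfst z)) (npair (psnd (pfst z)) (psnd z)))"])
       (simp add: dec_comp[OF R(1)] cf_intros)
qed

lemma re_conj [re_intros]:
  assumes "re P" "re Q"
  shows "re (\<lambda>x. P x \<and> Q x)"
proof -
  obtain R where R: "dec R" "\<And>x. P x \<longleftrightarrow> (\<exists>t. R (npair t x))"
    using assms(1) unfolding re_def by blast
  obtain R' where R': "dec R'" "\<And>x. Q x \<longleftrightarrow> (\<exists>t. R' (npair t x))"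
    using assms(2) unfolding re_def by blast
  have "re (\<lambda>x. \<exists>t. \<exists>t'. R (npair t x) \<and> R' (npair t' x))"
    by (rule re_ex, rule re_ex, rule re_dec) (intro dec_conj dec_comp[OF R(1)] dec_comp[OF R'(1)] cf_intros)
  then show ?thesis by (simp add: R(2) R'(2))
qed

lemma re_disj [re_intros]:
  assumes "re P" "re Q"
  shows "re (\<lambda>x. P x \<or> Q x)"
proof -
  obtain R where R: "dec R" "\<And>x. P x \<longleftrightarrow> (\<exists>t. R (npair t x))"
    using assms(1) unfolding re_def by blast
  obtain R' where R': "dec R'" "\<And>x. Q x \<longleftrightarrow> (\<exists>t. R' (npair t x))"
    using assms(2) unfolding re_def by blast
  have "re (\<lambda>x. \<exists>t. R (npair t x) \<or> R' (npair t x))"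
    by (rule re_ex, rule re_dec) (intro dec_disj dec_comp[OF R(1)] dec_comp[OF R'(1)] cf_intros)
  then show ?thesis by (simp add: R(2) R'(2) ex_disj_distrib)
qed

text \<open>For each \<open>x\<close> the answer found first is selected: \<open>s\<close> runs
  through all pairs of a witness and an answer, and the least successful pair decides. Minimality is
  a bounded quantifier over a decidable predicate, so \<open>F\<close> stays enumerable.\<close>

lemma re_uniformize:
  assumes "re (\<lambda>z. P (pfst z) (psnd z))"
  obtains F where "re (\<lambda>z. F (pfst z) (psnd z))" "\<And>x y. F x y \<Longrightarrow> P x y"
    "\<And>x y y'. F x y \<Longrightarrow> F x y' \<Longrightarrow> y = y'" "\<And>x y. P x y \<Longrightarrow> \<exists>y. F x y"
proof -
  obtain R where R: "dec R" "\<And>z. P (pfst z) (psnd z) \<longleftrightarrow> (\<exists>t. R (npair t z))"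
    using assms unfolding re_def by blast
  have P: "P x y \<longleftrightarrow> (\<exists>t. R (npair t (npair x y)))" for x y
    using R(2)[of "npair x y"] by simp
  define Q where "Q s x \<longleftrightarrow> R (npair (pfst s) (npair x (psnd s)))" for s x
  define F where "F x y \<longleftrightarrow> (\<exists>s. Q s x \<and> (\<forall>s'<s. \<not> Q s' x) \<and> psnd s = y)" for x y
  show thesis
  proof
    show "re (\<lambda>z. F (pfst z) (psnd z))"
      unfolding F_def Q_def by (intro re_intros re_dec dec_ball dec_not dec_comp[OF R(1)] cf_intros)
    show "P x y" if "F x y" for x y using that by (auto simp: F_def Q_def P)
    show "y = y'" if "F x y" "F x y'" for x y y'
      using that unfolding F_def by (metis linorder_neqE_nat)
    show "\<exists>y. F x y" if xy: "P x y" for x y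
    proof -
      obtain t where "R (npair t (npair x y))" using xy P by blast
      then have "Q (npair t y) x" by (simp add: Q_def)
      then show ?thesis using exists_least_iff[of "\<lambda>s. Q s x"] unfolding F_def by blast
    qed
  qed
qed

text \<open>Every number codes an infinite sequence; no length is stored because only initial
  segments are ever prescribed.\<close>

definition seq_nth :: "nat \<Rightarrow> nat \<Rightarrow> nat" where
  "seq_nth c i = pfst (rec_nat c (\<lambda>_ r. psnd r) i)"

lemma seq_nth_exists: "\<exists>c. \<forall>i\<le>n. seq_nth c i = f i"
proof (induction n arbitrary: f)
  case 0
  then show ?case by (auto simp: seq_nth_def intro: exI[of _ "npair (f 0) 0"])
next
  case (Suc n)
  obtain c where c: "\<forall>i\<le>n. seq_nth c i = f (Suc i)" using Suc[of "\<lambda>i. f (Suc i)"] by blast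
  have shift: "rec_nat (npair x c) (\<lambda>_ r. psnd r) (Suc i) = rec_nat c (\<lambda>_ r. psnd r) i" for i x
    by (induction i) auto
  have "seq_nth (npair (f 0) c) i = f i" if "i \<le> Suc n" for i
    using that c shift by (cases i) (auto simp: seq_nth_def)
  then show ?case by blast
qed

lemma cf_seq_nth [cf_intros]: "cf f \<Longrightarrow> cf g \<Longrightarrow> cf (\<lambda>x. seq_nth (f x) (g x))"
  unfolding seq_nth_def by (intro cf_intros)

text \<open>A path is coded by two sequences, its states \<open>c\<close> and the witnesses
  \<open>c'\<close> of its steps; with the witnesses guessed in advance, a bounded quantifier over a
  decidable predicate remains. Later enumerability proofs describe a process by its steps and use
  this closure.\<close>

lemma re_rtranclp:
  assumes "re (\<lambda>z. P (pfst z) (psnd z))"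
  shows "re (\<lambda>z. P\<^sup>*\<^sup>* (pfst z) (psnd z))"
proof -
  obtain R where R: "dec R" "\<And>z. P (pfst z) (psnd z) \<longleftrightarrow> (\<exists>t. R (npair t z))"
    using assms unfolding re_def by blast
  have P: "P x y \<longleftrightarrow> (\<exists>t. R (npair t (npair x y)))" for x y
    using R(2)[of "npair x y"] by simp
  have path: "P\<^sup>*\<^sup>* x y \<longleftrightarrow> (\<exists>n c c'. seq_nth c 0 = x \<and> seq_nth c n = y \<and>
      (\<forall>i<n. R (npair (seq_nth c' i) (npair (seq_nth c i) (seq_nth c (Suc i))))))" for x y
  proof
    assume "P\<^sup>*\<^sup>* x y"
    then obtain n where "(P ^^ n) x y" using rtranclp_imp_relpowp by metis
    then obtain s where s: "s 0 = x" "s n = y" "\<And>i. i < n \<Longrightarrow> P (s i) (s (Suc i))"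
      unfolding relpowp_fun_conv by blast
    then obtain t where t: "\<And>i. i < n \<Longrightarrow> R (npair (t i) (npair (s i) (s (Suc i))))"
      unfolding P by metis
    obtain c c' where "\<forall>i\<le>n. seq_nth c i = s i" "\<forall>i\<le>n. seq_nth c' i = t i"
      using seq_nth_exists by metis
    then show "\<exists>n c c'. seq_nth c 0 = x \<and> seq_nth c n = y \<and>
      (\<forall>i<n. R (npair (seq_nth c' i) (npair (seq_nth c i) (seq_nth c (Suc i)))))"
      using s t by (intro exI[of _ n] exI[of _ c] exI[of _ c']) auto
  next
    assume "\<exists>n c c'. seq_nth c 0 = x \<and> seq_nth c n = y \<and>
      (\<forall>i<n. R (npair (seq_nth c' i) (npair (seq_nth c i) (seq_nth c (Suc i)))))"
    then obtain n c where "seq_nth c 0 = x" "seq_nth c n = y"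
      "\<And>i. i < n \<Longrightarrow> P (seq_nth c i) (seq_nth c (Suc i))"
      unfolding P by blast
    then have "(P ^^ n) x y" unfolding relpowp_fun_conv by blast
    then show "P\<^sup>*\<^sup>* x y" by (rule relpowp_imp_rtranclp)
  qed
  show ?thesis
    unfolding path by (intro re_intros re_dec dec_ball dec_comp[OF R(1)] cf_intros)
qed

lemma re_rtranclp':
  assumes "re (\<lambda>z. P (pfst z) (psnd z))" "cf f" "cf g"
  shows "re (\<lambda>x. P\<^sup>*\<^sup>* (f x) (g x))"
  using re_comp[OF re_rtranclp[OF assms(1)] cf_npair[OF assms(2,3)]] by simp

section \<open>From enumerable predicates back to programs\<close>

lemma dec_search:
  assumes "dec R"
  obtains e where "\<And>x s. eval e [x] s \<longleftrightarrow> R (npair s x) \<and> (\<forall>s'<s. \<not> R (npair s' x))"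
proof -
  \<comment> \<open>Success is coded by 0, the value at which \<open>Mn\<close> stops.\<close>
  from computable_comp1[where f = "\<lambda>z. of_bool (\<not> R z)",
      OF dec_not[OF assms, unfolded dec_def cf_iff] computable_npair]
  obtain g where "\<And>xs. length xs = 2 \<Longrightarrow> eval g xs (of_bool (\<not> R (npair (xs ! 0) (xs ! 1))))"
    unfolding computable_def by blast
  from this[of "[_, _]"] have "eval g [s, x] (of_bool (\<not> R (npair s x)))" for s x by simp
  then have g: "eval g [s, x] y \<longleftrightarrow> y = of_bool (\<not> R (npair s x))" for s x y
    using eval_functional by blast
  have "eval (Mn g) [x] s \<longleftrightarrow> R (npair s x) \<and> (\<forall>s'<s. \<not> R (npair s' x))" for x s
  proof
    assume "eval (Mn g) [x] s"
    then show "R (npair s x) \<and> (\<forall>s'<s. \<not> R (npair s' x))"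
      by (cases rule: eval.cases) (auto simp: g split: if_splits)
  next
    assume "R (npair s x) \<and> (\<forall>s'<s. \<not> R (npair s' x))"
    then show "eval (Mn g) [x] s" by (intro eval_Mn) (auto simp: g)
  qed
  then show thesis using that by blast
qed

lemma ce_pred2I:
  assumes "re (\<lambda>z. P (pfst z) (psnd z))"
  shows "ce_pred2 P"
proof -
  obtain R where R: "dec R" "\<And>z. P (pfst z) (psnd z) \<longleftrightarrow> (\<exists>t. R (npair t z))"
    using assms unfolding re_def by blast
  obtain e where e: "\<And>x s. eval e [x] s \<longleftrightarrow> R (npair s x) \<and> (\<forall>s'<s. \<not> R (npair s' x))"
    using dec_search[OF R(1)] by blast
  have e': "(\<exists>s. eval e [x] s) \<longleftrightarrow> (\<exists>t. R (npair t x))" for x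
    unfolding e using exists_least_iff[of "\<lambda>s. R (npair s x)"] by blast
  obtain p where "\<And>xs. length xs = 2 \<Longrightarrow> eval p xs (npair (xs ! 0) (xs ! 1))"
    using computable_npair unfolding computable_def by blast
  from this[of "[_, _]"] have "eval p [x, k] (npair x k)" for x k by simp
  then have p: "eval p [x, k] z \<longleftrightarrow> z = npair x k" for x k z
    using eval_functional by blast
  have "eval (Comp e [p]) [x, k] y \<longleftrightarrow> eval e [npair x k] y" for x k y
  proof
    assume "eval (Comp e [p]) [x, k] y"
    then show "eval e [npair x k] y"
      by (cases rule: eval.cases) (auto simp: list_all2_Cons1 p)
  qed (auto intro!: eval_Comp simp: list_all2_Cons1 p)
  then have "P x k \<longleftrightarrow> (\<exists>y. eval (Comp e [p]) [x, k] y)" for x k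
    using R(2)[of "npair x k"] e' by simp
  then show ?thesis unfolding ce_pred2_def by blast
qed

text \<open>The search runs over pairs of a witness and a value. Whichever pair is found first, its
  value is right because \<open>f\<close> is single-valued.\<close>

lemma partial_computableI:
  assumes "re (\<lambda>z. f (pfst z) = Some (psnd z))"
  shows "partial_computable f"
proof -
  obtain R where R: "dec R" "\<And>z. f (pfst z) = Some (psnd z) \<longleftrightarrow> (\<exists>t. R (npair t z))"
    using assms unfolding re_def by blast
  have f: "f x = Some y \<longleftrightarrow> (\<exists>t. R (npair t (npair x y)))" for x y
    using R(2)[of "npair x y"] by simp
  define Q where "Q z \<longleftrightarrow> R (npair (pfst (pfst z)) (npair (psnd z) (psnd (pfst z))))" for z
  have "dec Q" unfolding Q_def by (intro dec_comp[OF R(1)] cf_intros)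
  then obtain e where e: "\<And>x s. eval e [x] s \<longleftrightarrow> Q (npair s x) \<and> (\<forall>s'<s. \<not> Q (npair s' x))"
    using dec_search by blast
  obtain q where "\<And>s. eval q [s] (psnd s)"
    using cf_psnd[OF cf_id] unfolding cf_def by blast
  then have q: "eval q [s] y \<longleftrightarrow> y = psnd s" for s y using eval_functional by blast
  have "f x = Some y \<longleftrightarrow> eval (Comp q [e]) [x] y" for x y
  proof
    assume "f x = Some y"
    then obtain t where "R (npair t (npair x y))" using f by blast
    then have "Q (npair (npair t y) x)" by (simp add: Q_def)
    then obtain s where s: "Q (npair s x)" "\<forall>s'<s. \<not> Q (npair s' x)"
      using exists_least_iff[of "\<lambda>s. Q (npair s x)"] by blast
    then have "f x = Some (psnd s)" using f by (auto simp: Q_def)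
    then have "y = psnd s" using \<open>f x = Some y\<close> by simp
    then show "eval (Comp q [e]) [x] y"
      using s by (auto intro!: eval_Comp[where ys = "[s]"] simp: e q)
  next
    assume "eval (Comp q [e]) [x] y"
    then obtain s where "Q (npair s x)" "y = psnd s"
      by (cases rule: eval.cases) (auto simp: list_all2_Cons1 e q)
    then show "f x = Some y" using f by (auto simp: Q_def)
  qed
  then show ?thesis unfolding partial_computable_def by blast
qed

section \<open>Universal evaluation\<close>

text \<open>A proof system whose judgements are numbers. Each rule has two premises; a rule with a
  single premise repeats it.\<close>

inductive derivable :: "(nat \<Rightarrow> bool) \<Rightarrow> (nat \<Rightarrow> nat \<Rightarrow> nat \<Rightarrow> bool) \<Rightarrow> nat \<Rightarrow> bool"
  for B R where
  derivable_axiom: "B c \<Longrightarrow> derivable B R c"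
| derivable_rule: "R p q c \<Longrightarrow> derivable B R p \<Longrightarrow> derivable B R q \<Longrightarrow> derivable B R c"

lemma derivable_rule1: "R p p c \<Longrightarrow> derivable B R p \<Longrightarrow> derivable B R c"
  by (rule derivable_rule)

abbreviation ncons :: "nat \<Rightarrow> nat \<Rightarrow> nat" where "ncons x r \<equiv> Suc (npair x r)"

text \<open>Derivability is enumerable because it is reachability of the empty stack of open goals.\<close>
lemma re_derivable:
  assumes "re B" "re (\<lambda>z. R (pfst z) (pfst (psnd z)) (psnd (psnd z)))"
  shows "re (derivable B R)"
proof -
  define P where "P s s' \<longleftrightarrow> (\<exists>c r. s = ncons c r \<and>
    (B c \<and> s' = r \<or> (\<exists>p q. R p q c \<and> s' = ncons p (ncons q r))))" for s s'
  have R: "re (\<lambda>x. R (f x) (g x) (h x))" if "cf f" "cf g" "cf h" for f g h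
    using re_comp[OF assms(2) cf_npair[OF that(1) cf_npair[OF that(2,3)]]] by simp
  have P: "re (\<lambda>z. P (pfst z) (psnd z))"
    unfolding P_def by (intro re_intros re_comp[OF assms(1)] R cf_intros)
  have pop: "P\<^sup>*\<^sup>* (ncons c r) r" if "derivable B R c" for c r
    using that
  proof (induction arbitrary: r)
    case (derivable_axiom c)
    then show ?case by (auto simp: P_def)
  next
    case (derivable_rule p q c)
    then have "P (ncons c r) (ncons p (ncons q r))" unfolding P_def by blast
    with derivable_rule.IH show ?case
      by (meson converse_rtranclp_into_rtranclp rtranclp_trans)
  qed
  \<comment> \<open>The invariant that all goals on the stack are derivable is a recursion along the
    stack, phrased as another instance of \<open>derivable\<close> with the empty stack as its
    axiom.\<close>
  define good where "good = derivable (\<lambda>s. s = 0) (\<lambda>p q s. \<exists>c r. s = ncons c r \<and> p = r \<and> q = r \<and> derivable B R c)"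
  have good_ncons: "good (ncons c r) \<longleftrightarrow> derivable B R c \<and> good r" for c r
    unfolding good_def by (subst derivable.simps) auto
  have "good s" if "P\<^sup>*\<^sup>* s 0" for s
    using that
  proof (induction rule: converse_rtranclp_induct)
    case base
    then show ?case by (simp add: good_def derivable_axiom)
  next
    case (step s s')
    then show ?case
      unfolding P_def by (auto simp: good_ncons intro: derivable.intros)
  qed
  then have "derivable B R c \<longleftrightarrow> P\<^sup>*\<^sup>* (ncons c 0) 0" for c
    using pop good_ncons by blast
  moreover have "re (\<lambda>c. P\<^sup>*\<^sup>* (ncons c 0) 0)"
    by (intro re_rtranclp' P cf_intros)
  ultimately show ?thesis by presburger
qed

section \<open>A numbering of the programs\<close>

lemma list_encode_Cons [simp]: "list_encode (x # xs) = ncons x (list_encode xs)"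
  by (simp add: npair_def)

lemma list_decode_ncons [simp]: "list_decode (ncons x r) = x # list_decode r"
  by (simp add: npair_def)

declare list_encode.simps(2) [simp del] list_decode.simps(2) [simp del]

lemma pfst_le: "pfst z \<le> z" and psnd_le: "psnd z \<le> z"
  by (metis npair_def npair_surj le_prod_encode_1, metis npair_def npair_surj le_prod_encode_2)

text \<open>Makes \<open>decode\<close> terminate: it calls itself only under nonzero tags. At tag 0
  the inequality can fail.\<close>

lemma psnd_less:
  assumes "pfst z \<noteq> 0"
  shows "psnd z < z"
proof -
  have "m \<le> triangle m" for m by (induction m) auto
  from this[of "pfst z + psnd z"] show ?thesis
    using npair_surj[of z] assms by (simp add: npair_def prod_encode_def)
qed

lemma list_decode_le: "x \<in> set (list_decode c) \<Longrightarrow> x \<le> c"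
proof (induction c rule: less_induct)
  case (less c)
  show ?case
  proof (cases c)
    case (Suc z)
    have "list_decode c = pfst z # list_decode (psnd z)"
      using list_decode_ncons[of "pfst z" "psnd z"] Suc by simp
    then have "x = pfst z \<or> x \<in> set (list_decode (psnd z))"
      using less.prems by simp
    then show ?thesis
      using less.IH[of "psnd z"] Suc pfst_le[of z] psnd_le[of z] by auto
  qed (use less in simp)
qed

text \<open>Every number denotes a program, since all tags from 5 on mean \<open>Mn\<close>. The
  numbering is onto but not injective, so completeness is shown below for every index of a
  program.\<close>

function decode :: "nat \<Rightarrow> recf" where
  "decode n = (let t = pfst n; k = psnd n in
     if t = 0 then Z
     else if t = 1 then S
     else if t = 2 then Proj k
     else if t = 3 then Comp (decode (pfst k)) (map decode (list_decode (psnd k)))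
     else if t = 4 then Prec (decode (pfst k)) (decode (psnd k))
     else Mn (decode k))"
  by auto
termination
  by (relation "Wellfounded.measure id")
     (auto intro: le_less_trans[OF pfst_le psnd_less] le_less_trans[OF psnd_le psnd_less] psnd_less
        dest!: list_decode_le intro: le_less_trans[OF order_trans[OF _ psnd_le] psnd_less])

declare decode.simps [simp del]

lemma decode_simps [simp]:
  "decode (npair 0 k) = Z"
  "decode (npair (Suc 0) k) = S"
  "decode (npair 2 k) = Proj k"
  "decode (npair 3 (npair a b)) = Comp (decode a) (map decode (list_decode b))"
  "decode (npair 4 (npair a b)) = Prec (decode a) (decode b)"
  "decode (npair (t + 5) k) = Mn (decode k)"
  by (subst decode.simps, simp)+

lemma decode_cases:
  obtains (Z) k where "n = npair 0 k"
  | (S) k where "n = npair (Suc 0) k"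
  | (Proj) k where "n = npair 2 k"
  | (Comp) a b where "n = npair 3 (npair a b)"
  | (Prec) a b where "n = npair 4 (npair a b)"
  | (Mn) t k where "n = npair (t + 5) k"
proof -
  have n: "n = npair (pfst n) (psnd n)" "n = npair (pfst n) (npair (pfst (psnd n)) (psnd (psnd n)))"
    by simp_all
  consider "pfst n = 0" | "pfst n = Suc 0" | "pfst n = 2" | "pfst n = 3" | "pfst n = 4"
    | "pfst n = pfst n - 5 + 5"
    by linarith
  then show thesis
    by cases (use n that in metis)+
qed

lemma decode_surj: "\<exists>n. decode n = e"
proof (induction e)
  case (Comp f gs)
  then obtain h where h: "\<And>g. g \<in> set gs \<Longrightarrow> decode (h g) = g" by metis
  obtain a where "decode a = f" using Comp by blast
  then have "decode (npair 3 (npair a (list_encode (map h gs)))) = Comp f gs"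
    by (simp add: map_idI h)
  then show ?case by blast
next
  case (Prec f g)
  then show ?case using decode_simps(5) by metis
next
  case (Mn f)
  then show ?case using decode_simps(6) by metis
qed (use decode_simps in blast)+

text \<open>The auxiliary judgements break evaluation into rules with at most two premises:
  \<open>jevs\<close> runs through the argument list of \<open>Comp\<close>, \<open>jpos\<close>
  collects the successor values required below the result of \<open>Mn\<close>, and
  \<open>jnth\<close> looks up a list entry for \<open>Proj\<close>.\<close>

abbreviation "jev n xs y \<equiv> npair 0 (npair n (npair xs y))"
abbreviation "jevs gs xs ys \<equiv> npair 2 (npair gs (npair xs ys))"
abbreviation "jpos f n xs \<equiv> npair 3 (npair f (npair n xs))"
abbreviation "jnth xs i y \<equiv> npair 4 (npair xs (npair i y))"

inductive eval_axiom :: "nat \<Rightarrow> bool" where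
  ax_Z: "eval_axiom (jev (npair 0 k) xs 0)"
| ax_S: "eval_axiom (jev (npair (Suc 0) k) (ncons x xs) (Suc x))"
| ax_evs: "eval_axiom (jevs 0 xs 0)"
| ax_pos: "eval_axiom (jpos f 0 xs)"
| ax_nth: "eval_axiom (jnth (ncons x xs) 0 x)"

inductive eval_rule :: "nat \<Rightarrow> nat \<Rightarrow> nat \<Rightarrow> bool" where
  rule_nth: "p = jnth xs i y \<Longrightarrow> eval_rule p p (jnth (ncons x xs) (Suc i) y)"
| rule_Proj: "p = jnth xs i y \<Longrightarrow> eval_rule p p (jev (npair 2 i) xs y)"
| rule_evs: "eval_rule (jev g xs y) (jevs gs xs ys) (jevs (ncons g gs) xs (ncons y ys))"
| rule_Comp: "eval_rule (jevs gs xs ys) (jev f ys y) (jev (npair 3 (npair f gs)) xs y)"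
| rule_Prec0: "p = jev f xs y \<Longrightarrow> eval_rule p p (jev (npair 4 (npair f g)) (ncons 0 xs) y)"
| rule_PrecS: "eval_rule (jev (npair 4 (npair f g)) (ncons n xs) y) (jev g (ncons y (ncons n xs)) z)
    (jev (npair 4 (npair f g)) (ncons (Suc n) xs) z)"
| rule_pos: "eval_rule (jpos f n xs) (jev f (ncons n xs) (Suc y)) (jpos f (Suc n) xs)"
| rule_Mn: "eval_rule (jpos f n xs) (jev f (ncons n xs) 0) (jev (npair (t + 5) f) xs n)"

abbreviation "eval_derivable \<equiv> derivable eval_axiom eval_rule"

lemma re_eval_derivable: "re eval_derivable"
  unfolding eval_axiom.simps[abs_def] eval_rule.simps[abs_def]
  by (rule re_derivable; intro re_intros cf_intros)

lemma eval_derivable_sound: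
  "eval_derivable c \<Longrightarrow>
    (\<forall>n xs y. c = jev n xs y \<longrightarrow> eval (decode n) (list_decode xs) y) \<and>
    (\<forall>gs xs ys. c = jevs gs xs ys \<longrightarrow>
      list_all2 (\<lambda>g y. eval g (list_decode xs) y) (map decode (list_decode gs)) (list_decode ys)) \<and>
    (\<forall>f n xs. c = jpos f n xs \<longrightarrow> (\<forall>m<n. \<exists>y. eval (decode f) (m # list_decode xs) (Suc y))) \<and>
    (\<forall>xs i y. c = jnth xs i y \<longrightarrow> i < length (list_decode xs) \<and> list_decode xs ! i = y)"
proof (induction rule: derivable.induct)
  case (derivable_axiom c)
  then show ?case by cases (auto intro: eval.intros)
next
  case (derivable_rule p q c)
  from derivable_rule(1) derivable_rule.IH show ?case
    by cases (auto intro: eval.intros simp: less_Suc_eq)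
qed

lemma eval_derivable_nth: "i < length xs \<Longrightarrow> eval_derivable (jnth (list_encode xs) i (xs ! i))"
proof (induction xs arbitrary: i)
  case (Cons x xs)
  then show ?case
    by (cases i) (auto intro: derivable_axiom ax_nth derivable_rule1[where R = eval_rule, OF rule_nth[OF refl]])
qed simp

lemma eval_derivable_evs:
  "list_all2 (\<lambda>g y. \<forall>n. decode n = g \<longrightarrow> eval_derivable (jev n xs y)) (map decode ns) ys \<Longrightarrow>
    eval_derivable (jevs (list_encode ns) xs (list_encode ys))"
proof (induction ns arbitrary: ys)
  case Nil
  then show ?case by (auto intro: derivable_axiom ax_evs)
next
  case (Cons n ns)
  then show ?case by (auto simp: list_all2_Cons1 intro!: derivable_rule[where R = eval_rule, OF rule_evs])
qed

lemma eval_derivable_complete: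
  "eval e xs y \<Longrightarrow> decode n = e \<Longrightarrow> eval_derivable (jev n (list_encode xs) y)"
proof (induction arbitrary: n rule: eval.induct)
  case (eval_Z xs)
  then show ?case by (cases n rule: decode_cases) (auto intro: derivable_axiom ax_Z)
next
  case (eval_S x xs)
  then show ?case by (cases n rule: decode_cases) (auto intro: derivable_axiom ax_S)
next
  case (eval_Proj i xs)
  then show ?case
    by (cases n rule: decode_cases) (auto intro: derivable_rule1[where R = eval_rule, OF rule_Proj[OF refl]] eval_derivable_nth)
next
  case (eval_Comp xs gs ys f z)
  show ?case
  proof (cases n rule: decode_cases)
    case (Comp a b)
    have "list_all2 (\<lambda>g y. \<forall>n. decode n = g \<longrightarrow> eval_derivable (jev n (list_encode xs) y)) gs ys"
      using eval_Comp.IH(1) by (rule list_all2_mono) auto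
    then have "eval_derivable (jevs (list_encode (list_decode b)) (list_encode xs) (list_encode ys))"
      using Comp eval_Comp.prems by (intro eval_derivable_evs) auto
    moreover have "eval_derivable (jev a (list_encode ys) z)"
      using Comp eval_Comp by auto
    ultimately show ?thesis
      using derivable_rule[where R = eval_rule, OF rule_Comp] Comp by simp
  qed (use eval_Comp.prems in auto)
next
  case (eval_Prec0 f xs z g)
  then show ?case
    by (cases n rule: decode_cases) (auto intro: derivable_rule1[where R = eval_rule, OF rule_Prec0[OF refl]])
next
  case (eval_PrecS f g k xs y z)
  show ?case
  proof (cases n rule: decode_cases)
    case (Prec a b)
    then have "eval_derivable (jev (npair 4 (npair a b)) (ncons k (list_encode xs)) y)"
      "eval_derivable (jev b (ncons y (ncons k (list_encode xs))) z)"
      using eval_PrecS.IH(1)[of n] eval_PrecS.IH(2)[of b] eval_PrecS.prems by auto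
    then show ?thesis using derivable_rule[where R = eval_rule, OF rule_PrecS] Prec by simp
  qed (use eval_PrecS.prems in auto)
next
  case (eval_Mn f k xs)
  show ?case
  proof (cases n rule: decode_cases)
    case (Mn t a)
    have "eval_derivable (jpos a m (list_encode xs))" if "m \<le> k" for m
      using that
    proof (induction m)
      case 0
      then show ?case by (auto intro: derivable_axiom ax_pos)
    next
      case (Suc m)
      obtain y where "eval_derivable (jev a (ncons m (list_encode xs)) (Suc y))"
        using eval_Mn.IH(2)[rule_format, of m] eval_Mn.prems Mn Suc.prems by auto
      then show ?case using Suc by (auto intro!: derivable_rule[where R = eval_rule, OF rule_pos])
    qed
    then show ?thesis
      using eval_Mn.IH(1)[of a] eval_Mn.prems Mn derivable_rule[where R = eval_rule, OF rule_Mn] by auto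
  qed (use eval_Mn.prems in auto)
qed

definition univ :: "nat \<Rightarrow> nat \<Rightarrow> nat \<Rightarrow> bool" where
  "univ n x y \<longleftrightarrow> eval (decode n) [x] y"

lemma univ_functional: "univ n x y \<Longrightarrow> univ n x y' \<Longrightarrow> y = y'"
  unfolding univ_def by (rule eval_functional)

lemma re_univ [re_intros]:
  assumes "cf f" "cf g" "cf h"
  shows "re (\<lambda>x. univ (f x) (g x) (h x))"
proof -
  have "univ n x y \<longleftrightarrow> eval_derivable (jev n (ncons x 0) y)" for n x y
    unfolding univ_def
    using eval_derivable_sound[of "jev n (ncons x 0) y"] eval_derivable_complete[of _ "[x]" y n]
    by auto
  then show ?thesis
    by (simp, intro re_comp[OF re_eval_derivable] cf_intros assms)
qed

lemma partial_computable_univ: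
  assumes "partial_computable f"
  obtains n where "\<And>x y. f x = Some y \<longleftrightarrow> univ n x y"
  using assms decode_surj unfolding partial_computable_def univ_def by metis

section \<open>Strings as numbers\<close>

declare bits.simps [simp del]

text \<open>The binary value of the string with a leading 1, which avoids the subtraction in
  \<open>nat_of_str\<close>.\<close>

definition strval :: "str \<Rightarrow> nat" where
  "strval s = foldl (\<lambda>a b. 2 * a + (if b then 1 else 0)) 1 s"

lemma strval_Nil [simp]: "strval [] = 1"
  and strval_snoc [simp]: "strval (s @ [b]) = 2 * strval s + of_bool b"
  by (simp_all add: strval_def)

lemma strval_ge: "2 ^ length s \<le> strval s"
  and strval_less: "strval s < 2 ^ Suc (length s)"
  by (induction s rule: rev_induct) auto

text \<open>The leading 1 of \<open>t\<close> disappears in the middle of the string; it is added on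
  the left to avoid truncated subtraction.\<close>

lemma strval_append: "strval (s @ t) + 2 ^ length t = strval s * 2 ^ length t + strval t"
  by (induction t rule: rev_induct) (auto simp: append_assoc[symmetric] simp del: append_assoc)

lemma strval_pos: "strval s > 0"
  using strval_ge[of s] by (metis le_zero_eq neq0_conv power_not_zero zero_neq_numeral)

lemma bits_rec: "m > 1 \<Longrightarrow> bits m = bits (m div 2) @ [odd m]"
  by (subst bits.simps) simp

lemma bits_strval: "bits (strval s) = s"
proof (induction s rule: rev_induct)
  case (snoc b s)
  then show ?case
    using strval_pos[of s] bits_rec[of "strval (s @ [b])"] by (cases b) simp_all
qed (simp add: bits.simps)

lemma strval_bits: "m > 0 \<Longrightarrow> strval (bits m) = m"
proof (induction m rule: less_induct)
  case (less m)
  show ?case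
  proof (cases "m > 1")
    case True
    then have "strval (bits (m div 2)) = m div 2" by (intro less.IH) simp_all
    then have "strval (bits m) = 2 * (m div 2) + m mod 2"
      using True by (simp only: bits_rec strval_snoc mod_2_eq_odd)
    then show ?thesis by simp
  next
    case False
    then show ?thesis using less.prems by (simp add: bits.simps)
  qed
qed

lemma nat_of_str_eq: "nat_of_str s = strval s - 1"
  by (simp add: nat_of_str_def strval_def)

lemma str_of_nat_of_str [simp]: "str_of_nat (nat_of_str s) = s"
  using strval_pos[of s] by (simp add: str_of_nat_def nat_of_str_eq bits_strval)

lemma nat_of_str_of_nat [simp]: "nat_of_str (str_of_nat n) = n"
  by (simp add: str_of_nat_def nat_of_str_eq strval_bits)

lemma nat_of_str_eq_iff [simp]: "nat_of_str s = nat_of_str t \<longleftrightarrow> s = t"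
  by (metis str_of_nat_of_str)

abbreviation slen :: "nat \<Rightarrow> nat" where "slen n \<equiv> length (str_of_nat n)"

text \<open>Comparison with powers of two yields both the enumerability of the length and the number
  of strings of a given length.\<close>

lemma slen_iff: "slen n = l \<longleftrightarrow> 2 ^ l \<le> Suc n \<and> Suc n < 2 ^ Suc l"
proof -
  have "strval (str_of_nat n) = Suc n" by (simp add: str_of_nat_def strval_bits)
  then have *: "2 ^ slen n \<le> Suc n" "Suc n < 2 ^ Suc (slen n)"
    using strval_ge[of "str_of_nat n"] strval_less[of "str_of_nat n"] by simp_all
  show ?thesis
  proof
    assume "2 ^ l \<le> Suc n \<and> Suc n < 2 ^ Suc l"
    then have "(2::nat) ^ slen n < 2 ^ Suc l" "(2::nat) ^ l < 2 ^ Suc (slen n)"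
      using * by linarith+
    then show "slen n = l"
      using power_less_imp_less_exp[of "2::nat" "slen n" "Suc l"] power_less_imp_less_exp[of "2::nat" l "Suc (slen n)"]
      by linarith
  qed (use * in auto)
qed

lemma slen_set: "{n. slen n = l} = {2 ^ l - 1..<2 ^ Suc l - 1}"
  by (auto simp: slen_iff)

lemma finite_slen [simp]: "finite {n. slen n = l}"
  and card_slen: "card {n. slen n = l} = 2 ^ l"
  unfolding slen_set by simp_all

lemma cf_power2 [cf_intros]:
  assumes "cf f"
  shows "cf (\<lambda>x. 2 ^ f x)"
proof -
  have "rec_nat (Suc 0) (\<lambda>k r. 2 * r) n = (2::nat) ^ n" for n by (induction n) auto
  moreover have "cf (\<lambda>x. rec_nat 1 (\<lambda>k r. 2 * r) (f x))" by (intro cf_intros assms)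
  ultimately show ?thesis by simp
qed

lemma re_slen [re_intros]: "cf f \<Longrightarrow> cf g \<Longrightarrow> re (\<lambda>x. slen (f x) = g x)"
  unfolding slen_iff by (intro re_intros cf_intros)

text \<open>Supplies indices of concrete functions for use as letters of histories.\<close>

lemma re_univ_exists:
  assumes "re (\<lambda>z. P (pfst z) (psnd z))" "\<And>x y y'. P x y \<Longrightarrow> P x y' \<Longrightarrow> y = y'"
  obtains e where "\<And>x y. univ e x y \<longleftrightarrow> P x y"
proof -
  define f where "f x = (if \<exists>y. P x y then Some (THE y. P x y) else None)" for x
  have f: "f x = Some y \<longleftrightarrow> P x y" for x y
    unfolding f_def using assms(2) by (auto intro: theI)
  then have "partial_computable f" using assms(1) by (intro partial_computableI) simp
  then show thesis using that f by (metis partial_computable_univ)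
qed

section \<open>Histories\<close>

text \<open>A history lists, latest step first, the steps of a process starting at the number 0: the letter
  \<open>npair 0 e\<close> applies the partial computable function with index \<open>e\<close>, the letter \<open>npair 1 y\<close> replaces
  the current number \<open>v\<close> by a string \<open>y\<close> of length \<open>v\<close>, that is, it reads \<open>v\<close> further bits.\<close>
inductive run :: "nat list \<Rightarrow> nat \<Rightarrow> bool" where
  run_Nil: "run [] 0"
| run_app: "run h v \<Longrightarrow> univ e v y \<Longrightarrow> run (npair 0 e # h) y"
| run_read: "run h (slen y) \<Longrightarrow> run (npair 1 y # h) y"

lemma run_functional: "run h v \<Longrightarrow> run h v' \<Longrightarrow> v = v'"
proof (induction arbitrary: v' rule: run.induct)
  case run_Nil
  then show ?case by (auto elim: run.cases)
next
  case (run_app h v e y)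
  from run_app.prems obtain u where "run h u" "univ e u v'" by (auto elim: run.cases)
  then show ?case using run_app univ_functional by blast
next
  case (run_read h y)
  from run_read.prems show ?case by (auto elim: run.cases)
qed

text \<open>The bits read are left out; apart from them \<open>weight\<close> agrees with
  \<open>bit_cost\<close>. So few or cheap steps mean small weight, however many bits they
  read.\<close>

definition weight :: "nat \<Rightarrow> nat" where
  "weight a = (if pfst a = 0 then psnd a + 3 else 2)"

definition bit_cost :: "nat \<Rightarrow> nat" where
  "bit_cost a = (if pfst a = 0 then psnd a + 3 else slen (psnd a) + 2)"

definition hweight :: "nat list \<Rightarrow> nat" where "hweight h = sum_list (map weight h)"
definition hbits :: "nat list \<Rightarrow> nat" where "hbits h = sum_list (map bit_cost h)"

text \<open>Penalising the letters twice makes the total mass of the histories of weight at least \<open>k\<close>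
  decay geometrically in \<open>k\<close>.\<close>
definition mass :: "nat list set \<Rightarrow> real" where
  "mass H = (\<Sum>h\<in>H. (1/2) ^ (hbits h + hweight h))"

lemma hist_simps [simp]:
  "hweight [] = 0" "hweight (a # h) = weight a + hweight h"
  "hbits [] = 0" "hbits (a # h) = bit_cost a + hbits h"
  by (simp_all add: hweight_def hbits_def)

lemma letter_simps [simp]:
  "weight (npair 0 e) = e + 3" "weight (npair (Suc 0) y) = 2"
  "bit_cost (npair 0 e) = e + 3" "bit_cost (npair (Suc 0) y) = slen y + 2"
  by (simp_all add: weight_def bit_cost_def)

text \<open>A read weighs 2 however many bits it takes, but their number is determined by the
  earlier part of the history. Hence each history has only finitely many light extensions by one
  letter, and every letter has positive weight, which gives the induction.\<close>

lemma finite_light: "finite {h. (\<exists>v. run h v) \<and> hweight h < k}"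
proof (induction k)
  case (Suc k)
  let ?M = "\<lambda>k. {h. (\<exists>v. run h v) \<and> hweight h < k}"
  let ?L = "\<lambda>h. npair 0 ` {..k} \<union> npair 1 ` (\<Union>v\<in>{v. run h v}. {y. slen y = v})"
  have "{v. run h v} \<subseteq> {THE v. run h v}" for h
    using run_functional by (auto intro!: the_equality[symmetric])
  then have "finite {v. run h v}" for h by (meson finite.simps finite_subset)
  then have "finite (insert [] (\<Union>h\<in>?M k. (\<lambda>a. a # h) ` ?L h))"
    using Suc by auto
  moreover have "?M (Suc k) \<subseteq> insert [] (\<Union>h\<in>?M k. (\<lambda>a. a # h) ` ?L h)"
  proof
    fix h assume "h \<in> ?M (Suc k)"
    then obtain v where "run h v" "hweight h < Suc k" by blast
    then show "h \<in> insert [] (\<Union>h\<in>?M k. (\<lambda>a. a # h) ` ?L h)"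
      by cases auto
  qed
  ultimately show ?case by (rule finite_subset[rotated])
qed simp

lemma sum_half_power_le: "finite E \<Longrightarrow> (\<Sum>e\<in>E. (1/2::real) ^ e) \<le> 2"
proof -
  assume "finite E"
  then have "(\<Sum>e\<in>E. (1/2::real) ^ e) \<le> (\<Sum>e. (1/2) ^ e)"
    by (intro sum_le_suminf summable_geometric) auto
  also have "\<dots> = 2" by (subst suminf_geometric) auto
  finally show ?thesis .
qed

text \<open>Applications contribute at most \<open>1/8\<close> times a geometric series with sum 2,
  and each of the \<open>2 ^ v\<close> possible reads contributes \<open>(1/2) ^ (v + 2)\<close>: at
  most 1/4 from either kind.\<close>

lemma letters_bound:
  assumes "finite L" "run h v" "\<And>a. a \<in> L \<Longrightarrow> \<exists>y. run (a # h) y"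
  shows "(\<Sum>a\<in>L. (1/2::real) ^ bit_cost a) \<le> 1/2"
proof -
  define E where "E = {e. npair 0 e \<in> L}"
  define Y where "Y = {y. slen y = v}"
  have fE: "finite E"
    unfolding E_def using assms(1) by (rule finite_vimageI[where h = "npair 0", unfolded vimage_def]) (auto intro: injI)
  have L: "L \<subseteq> npair 0 ` E \<union> npair 1 ` Y"
  proof
    fix a assume "a \<in> L"
    then obtain y where "run (a # h) y" using assms(3) by blast
    then show "a \<in> npair 0 ` E \<union> npair 1 ` Y"
      by cases (use \<open>a \<in> L\<close> assms(2) in \<open>auto simp: E_def Y_def dest: run_functional\<close>)
  qed
  have E_sum: "(\<Sum>a\<in>npair 0 ` E. (1/2::real) ^ bit_cost a) = (\<Sum>e\<in>E. (1/2) ^ e) * (1/8)"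
  proof -
    have "(1/2::real) ^ (e + 3) = (1/2) ^ e * (1/8)" for e
      by (simp only: power_add) (simp add: power_divide)
    then have "(\<Sum>e\<in>E. (1/2::real) ^ bit_cost (npair 0 e)) = (\<Sum>e\<in>E. (1/2) ^ e * (1/8))"
      by (simp only: letter_simps)
    then show ?thesis
      by (subst sum.reindex) (simp_all add: inj_on_def o_def sum_distrib_right)
  qed
  have "(\<Sum>a\<in>npair 1 ` Y. (1/2::real) ^ bit_cost a) = (\<Sum>y\<in>Y. (1/2) ^ bit_cost (npair 1 y))"
    by (subst sum.reindex) (simp_all add: inj_on_def o_def)
  also have "\<dots> = (\<Sum>y\<in>Y. (1/2) ^ (v + 2))"
    by (rule sum.cong) (simp_all add: Y_def)
  also have "\<dots> = real (2 ^ v) * (1/2) ^ (v + 2)"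
    by (simp only: sum_constant) (simp add: Y_def card_slen)
  also have "\<dots> = 1/4" by (simp add: power_add power_divide)
  finally have Y_sum: "(\<Sum>a\<in>npair 1 ` Y. (1/2::real) ^ bit_cost a) = 1/4" .
  have "(\<Sum>a\<in>L. (1/2::real) ^ bit_cost a) \<le> (\<Sum>a\<in>npair 0 ` E \<union> npair 1 ` Y. (1/2) ^ bit_cost a)"
    using fE L by (intro sum_mono2) (auto simp: Y_def)
  also have "\<dots> = (\<Sum>a\<in>npair 0 ` E. (1/2) ^ bit_cost a) + (\<Sum>a\<in>npair 1 ` Y. (1/2) ^ bit_cost a)"
    using fE by (intro sum.union_disjoint) (auto simp: Y_def)
  finally show ?thesis using sum_half_power_le[OF fE] unfolding E_sum Y_sum by linarith
qed

text \<open>Summing over the latest letter, the head of the list, gains a factor 1/2 by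
  \<open>letters_bound\<close>.\<close>

lemma hbits_bound_length:
  assumes "finite H" "\<And>h. h \<in> H \<Longrightarrow> \<exists>v. run h v" "\<And>h. h \<in> H \<Longrightarrow> length h = r"
  shows "(\<Sum>h\<in>H. (1/2::real) ^ hbits h) \<le> (1/2) ^ r"
  using assms
proof (induction r arbitrary: H)
  case 0
  then have "H \<subseteq> {[]}" by auto
  then consider "H = {}" | "H = {[]}" by blast
  then show ?case by cases simp_all
next
  case (Suc r)
  define T where "T = tl ` H"
  define L where "L h = {a. a # h \<in> H}" for h
  have finL: "finite (L h)" for h
    unfolding L_def using Suc.prems(1)
    by (rule finite_vimageI[where h = "\<lambda>a. a # h", unfolded vimage_def]) (auto intro: injI)
  have H: "H = (\<lambda>(h, a). a # h) ` Sigma T L"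
    unfolding T_def L_def
  proof (intro equalityI subsetI)
    fix h assume "h \<in> H"
    moreover from this have "h = hd h # tl h" using Suc.prems(3)[of h] by (cases h) auto
    ultimately show "h \<in> (\<lambda>(h, a). a # h) ` (SIGMA h:tl ` H. {a. a # h \<in> H})"
      by (intro image_eqI[of _ _ "(tl h, hd h)"]) auto
  qed auto
  have run_tl: "\<exists>v. run h v" if "h \<in> T" for h
  proof -
    obtain h' where h': "h' \<in> H" "h = tl h'" using \<open>h \<in> T\<close> unfolding T_def by blast
    then obtain a where "h' = a # h" using Suc.prems(3)[of h'] by (cases h') auto
    with h'(1) have "a # h \<in> H" by simp
    then obtain v where "run (a # h) v" using Suc.prems(2) by blast
    then show ?thesis by cases auto
  qed
  have "(\<Sum>h\<in>H. (1/2::real) ^ hbits h) = (\<Sum>(h, a)\<in>Sigma T L. (1/2) ^ bit_cost a * (1/2) ^ hbits h)"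
    unfolding H by (subst sum.reindex) (auto intro!: inj_onI sum.cong simp: power_add)
  also have "\<dots> = (\<Sum>h\<in>T. (\<Sum>a\<in>L h. (1/2) ^ bit_cost a) * (1/2) ^ hbits h)"
    using Suc.prems(1) finL by (subst sum.Sigma[symmetric]) (auto simp: T_def sum_distrib_right)
  also have "\<dots> \<le> (\<Sum>h\<in>T. 1/2 * (1/2) ^ hbits h)"
  proof (intro sum_mono mult_right_mono)
    fix h assume "h \<in> T"
    then obtain v where "run h v" using run_tl by blast
    then show "(\<Sum>a\<in>L h. (1/2::real) ^ bit_cost a) \<le> 1/2"
      using Suc.prems(2) by (intro letters_bound[OF finL]) (auto simp: L_def)
  qed simp
  also have "\<dots> = 1/2 * (\<Sum>h\<in>T. (1/2) ^ hbits h)" by (simp add: sum_distrib_left)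
  also have "\<dots> \<le> 1/2 * (1/2) ^ r"
    using Suc.prems run_tl by (intro mult_left_mono Suc.IH) (auto simp: T_def)
  finally show ?case by simp
qed

lemma hbits_bound:
  assumes "finite H" "\<And>h. h \<in> H \<Longrightarrow> \<exists>v. run h v"
  shows "(\<Sum>h\<in>H. (1/2::real) ^ hbits h) \<le> 2"
proof -
  have "(\<Sum>h\<in>H. (1/2::real) ^ hbits h) = (\<Sum>r\<in>length ` H. \<Sum>h\<in>{h\<in>H. length h = r}. (1/2) ^ hbits h)"
    by (rule sum.image_gen[OF assms(1)])
  also have "\<dots> \<le> (\<Sum>r\<in>length ` H. (1/2) ^ r)"
    using assms by (intro sum_mono hbits_bound_length) auto
  also have "\<dots> \<le> 2" using assms(1) by (intro sum_half_power_le) auto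
  finally show ?thesis .
qed

text \<open>One copy of the penalty is at most \<open>(1/2) ^ k\<close>; the other one, contained in
  \<open>hbits\<close>, already makes the remaining sum at most 2.\<close>

lemma mass_bound:
  assumes "finite H" "\<And>h. h \<in> H \<Longrightarrow> (\<exists>v. run h v) \<and> k \<le> hweight h"
  shows "mass H \<le> 2 * (1/2) ^ k"
proof -
  have "mass H \<le> (\<Sum>h\<in>H. (1/2) ^ k * (1/2) ^ hbits h)"
    unfolding mass_def power_add using assms(2)
    by (intro sum_mono) (auto simp: mult.commute intro!: mult_right_mono power_decreasing)
  also have "\<dots> = (1/2) ^ k * (\<Sum>h\<in>H. (1/2) ^ hbits h)" by (simp add: sum_distrib_left)
  also have "\<dots> \<le> (1/2) ^ k * 2"
    using assms by (intro mult_left_mono hbits_bound) auto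
  finally show ?thesis by simp
qed

text \<open>A history determines the number at which it ends, so the sets are disjoint.\<close>

lemma mass_UN:
  assumes "finite X" "\<And>x. x \<in> X \<Longrightarrow> finite (H x)" "\<And>x h. x \<in> X \<Longrightarrow> h \<in> H x \<Longrightarrow> run h x"
  shows "mass (\<Union>x\<in>X. H x) = (\<Sum>x\<in>X. mass (H x))"
  unfolding mass_def using assms run_functional by (intro sum.UNION_disjoint) blast+

lemma mass_Cons: "mass ((#) a ` H) = (1/2) ^ (bit_cost a + weight a) * mass H"
  unfolding mass_def
  by (subst sum.reindex) (auto simp: sum_distrib_left power_add intro!: sum.cong)

section \<open>The complexity function\<close>

definition light :: "nat \<Rightarrow> nat \<Rightarrow> bool" where
  "light k x \<longleftrightarrow> (\<exists>h. run h x \<and> hweight h < k)"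

text \<open>Finite sets stand in for the sum over all histories, so that success has a finite
  witness. The case \<open>k = 0\<close> defines \<open>cplx\<close>; a large \<open>k\<close>
  leaves only histories of small total mass.\<close>

definition heavy :: "nat \<Rightarrow> nat \<Rightarrow> nat \<Rightarrow> bool" where
  "heavy k x l \<longleftrightarrow> (\<exists>H. finite H \<and> (\<forall>h\<in>H. run h x \<and> k \<le> hweight h) \<and> (1/2) ^ l \<le> mass H)"

definition cplx :: "nat \<Rightarrow> nat" where "cplx x = (LEAST l. heavy 0 x l)"

lemma heavy_mono: "heavy k x l \<Longrightarrow> l \<le> l' \<Longrightarrow> heavy k x l'"
proof -
  assume "heavy k x l" "l \<le> l'"
  then obtain H where "finite H" "\<forall>h\<in>H. run h x \<and> k \<le> hweight h" "(1/2) ^ l \<le> mass H"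
    unfolding heavy_def by blast
  moreover have "(1/2::real) ^ l' \<le> (1/2) ^ l"
    using \<open>l \<le> l'\<close> by (intro power_decreasing) simp_all
  ultimately show ?thesis
    unfolding heavy_def by (intro exI[of _ H] conjI) linarith+
qed

text \<open>A constant function applied at the start reaches \<open>x\<close>, so the minimum in
  \<open>cplx\<close> exists.\<close>

lemma heavy_exists: "\<exists>l. heavy 0 x l"
proof -
  obtain e where e: "\<And>z y. univ e z y \<longleftrightarrow> y = x"
    by (rule re_univ_exists[of "\<lambda>z y. y = x"]) (auto intro!: re_intros cf_intros)
  have "run [npair 0 e] x" using run_app[OF run_Nil] e by blast
  then have "heavy 0 x (hbits [npair 0 e] + hweight [npair 0 e])"
    unfolding heavy_def by (intro exI[of _ "{[npair 0 e]}"]) (simp add: mass_def)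
  then show ?thesis by blast
qed

lemma cplx_le_iff: "cplx x \<le> l \<longleftrightarrow> heavy 0 x l"
proof
  assume "cplx x \<le> l"
  moreover have "heavy 0 x (cplx x)" unfolding cplx_def using heavy_exists by (rule LeastI_ex)
  ultimately show "heavy 0 x l" using heavy_mono by blast
next
  assume "heavy 0 x l"
  then show "cplx x \<le> l" unfolding cplx_def by (rule Least_le)
qed

lemma cplx_histories: "\<exists>H. finite H \<and> (\<forall>h\<in>H. run h x) \<and> (1/2) ^ cplx x \<le> mass H"
  using cplx_le_iff[of x "cplx x"] unfolding heavy_def by auto

text \<open>By minimality of \<open>cplx\<close>, the next smaller exponent is not reached; this
  costs the factor 2.\<close>

lemma mass_le_cplx:
  assumes "finite H" "\<And>h. h \<in> H \<Longrightarrow> run h x"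
  shows "mass H \<le> 2 * (1/2) ^ cplx x"
proof (cases "cplx x")
  \<comment> \<open>There is no smaller exponent; the bound on the total mass takes its
    place.\<close>
  case 0
  have "mass H \<le> 2 * (1/2) ^ 0" using assms by (intro mass_bound) auto
  then show ?thesis using 0 by simp
next
  case (Suc l)
  have "mass H < (1/2) ^ l"
  proof (rule ccontr)
    assume "\<not> mass H < (1/2) ^ l"
    then have "heavy 0 x l"
      unfolding heavy_def using assms by (intro exI[of _ H]) auto
    then show False using Suc by (simp add: cplx_le_iff[symmetric])
  qed
  moreover have "(1/2::real) ^ l = 2 * (1/2) ^ cplx x" by (simp only: Suc power_Suc)
  ultimately show ?thesis by linarith
qed

text \<open>Prepending \<open>a\<close> is injective and multiplies the mass by a constant. With the
  two kinds of letters this gives closure under partial computable functions and the bound by the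
  length.\<close>

lemma cplx_step:
  assumes "\<And>h. run h x \<Longrightarrow> run (a # h) y"
  shows "cplx y \<le> cplx x + (bit_cost a + weight a)"
proof -
  obtain H where H: "finite H" "\<And>h. h \<in> H \<Longrightarrow> run h x" "(1/2) ^ cplx x \<le> mass H"
    using cplx_histories[of x] by blast
  have "(1/2) ^ (cplx x + (bit_cost a + weight a)) \<le> mass ((#) a ` H)"
    using H(3) by (simp add: mass_Cons power_add)
  then show ?thesis
    unfolding cplx_le_iff heavy_def using H assms by (intro exI[of _ "(#) a ` H"]) auto
qed

lemma cplx_app: "univ e x y \<Longrightarrow> cplx y \<le> cplx x + 2 * (e + 3)"
  using cplx_step[of x "npair 0 e" y] run_app by fastforce

lemma cplx_read: "cplx y \<le> cplx (slen y) + (slen y + 4)"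
  using cplx_step[of "slen y" "npair 1 y" y] run_read by fastforce

text \<open>The numbers share the mass of the histories of weight at least \<open>k\<close>. With
  \<open>k = 0\<close> this gives summability; with a large \<open>k\<close> it limits how often
  expensive histories can answer the machine.\<close>

lemma sum_heavy_bound:
  assumes "finite X" "\<And>x. x \<in> X \<Longrightarrow> heavy k x (f x)"
  shows "(\<Sum>x\<in>X. (1/2) ^ f x) \<le> 2 * (1/2::real) ^ k"
proof -
  obtain H where H: "\<forall>x\<in>X. finite (H x) \<and> (\<forall>h\<in>H x. run h x \<and> k \<le> hweight h) \<and> (1/2) ^ f x \<le> mass (H x)"
    using bchoice[of X "\<lambda>x H. finite H \<and> (\<forall>h\<in>H. run h x \<and> k \<le> hweight h) \<and> (1/2) ^ f x \<le> mass H"]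
      assms(2) unfolding heavy_def by blast
  then have "(\<Sum>x\<in>X. (1/2) ^ f x) \<le> (\<Sum>x\<in>X. mass (H x))" by (intro sum_mono) auto
  also have "\<dots> = mass (\<Union>x\<in>X. H x)" using assms(1) H by (intro mass_UN[symmetric]) auto
  also have "\<dots> \<le> 2 * (1/2) ^ k" using assms(1) H by (intro mass_bound) auto
  finally show ?thesis .
qed

lemma sum_cplx_slen:
  obtains C :: real where
    "\<And>X n. finite X \<Longrightarrow> (\<And>x. x \<in> X \<Longrightarrow> slen x = n) \<Longrightarrow> (\<Sum>x\<in>X. (1/2) ^ cplx x) \<le> C * (1/2) ^ cplx n"
proof -
  obtain e where e: "\<And>z y. univ e z y \<longleftrightarrow> slen z = y"
    by (rule re_univ_exists[of "\<lambda>z y. slen z = y"]) (auto intro!: re_intros cf_intros)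
  obtain H where H: "\<And>x. finite (H x)" "\<And>x h. h \<in> H x \<Longrightarrow> run h x" "\<And>x. (1/2) ^ cplx x \<le> mass (H x)"
    using choice[of "\<lambda>x H. finite H \<and> (\<forall>h\<in>H. run h x) \<and> (1/2) ^ cplx x \<le> mass H"] cplx_histories
    by blast
  show thesis
  \<comment> \<open>The first 2 comes from \<open>mass_le_cplx\<close>; the power undoes the cost of
    the letter for the length function, its penalty \<open>e + 3\<close> counted twice.\<close>
  proof (rule that[of "2 * 2 ^ (2 * (e + 3))"])
    fix X n assume X: "finite X" "\<And>x. x \<in> X \<Longrightarrow> slen x = n"
    let ?H = "\<Union>x\<in>X. H x"
    have "(\<Sum>x\<in>X. (1/2) ^ cplx x) \<le> (\<Sum>x\<in>X. mass (H x))" by (intro sum_mono H)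
    also have "\<dots> = mass ?H" using X H by (intro mass_UN[symmetric]) auto
    also have "\<dots> = 2 ^ (2 * (e + 3)) * mass ((#) (npair 0 e) ` ?H)"
      by (simp add: mass_Cons flip: power_add power_mult_distrib)
    also have "\<dots> \<le> 2 ^ (2 * (e + 3)) * (2 * (1/2) ^ cplx n)"
      using X H e by (intro mult_left_mono mass_le_cplx) (auto intro!: run_app)
    finally show "(\<Sum>x\<in>X. (1/2::real) ^ cplx x) \<le> 2 * 2 ^ (2 * (e + 3)) * (1/2) ^ cplx n"
      by simp
  qed
qed

section \<open>Enumerability of the histories and of the complexity\<close>

definition run_code :: "nat \<Rightarrow> nat \<Rightarrow> nat \<Rightarrow> nat \<Rightarrow> bool" where
  "run_code c v p w \<longleftrightarrow> run (list_decode c) v \<and> hbits (list_decode c) = p \<and> hweight (list_decode c) = w"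

lemma re_run_code [re_intros]:
  assumes "cf f1" "cf f2" "cf f3" "cf f4"
  shows "re (\<lambda>x. run_code (f1 x) (f2 x) (f3 x) (f4 x))"
proof -
  let ?st = "\<lambda>c v p w. npair c (npair v (npair p w))"
  \<comment> \<open>A history is built letter by letter together with its end and both totals. The
    length enters through \<open>l\<close> because \<open>slen\<close> is available only as an
    enumerable relation.\<close>
  define P where "P s s' \<longleftrightarrow>
     (\<exists>c v p w e y. s = ?st c v p w \<and> univ e v y \<and> s' = ?st (ncons (npair 0 e) c) y (e + 3 + p) (e + 3 + w))
   \<or> (\<exists>c p w y l. slen y = l \<and> s = ?st c l p w \<and> s' = ?st (ncons (npair 1 y) c) y (l + 2 + p) (2 + w))" for s s'
  have P: "re (\<lambda>z. P (pfst z) (psnd z))"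
    unfolding P_def by (intro re_intros cf_intros)
  have sound: "\<exists>h v. run h v \<and> s = ?st (list_encode h) v (hbits h) (hweight h)" if "P\<^sup>*\<^sup>* (?st 0 0 0 0) s" for s
    using that
  proof (induction rule: rtranclp_induct)
    case base
    show ?case by (rule exI[of _ "[]"], rule exI[of _ 0]) (simp add: run_Nil)
  next
    case (step s s')
    then obtain h v where h: "run h v" "s = ?st (list_encode h) v (hbits h) (hweight h)" by blast
    from step.hyps(2) consider
        (app) e y where "univ e v y"
          "s' = ?st (ncons (npair 0 e) (list_encode h)) y (e + 3 + hbits h) (e + 3 + hweight h)"
      | (read) y where "slen y = v"
          "s' = ?st (ncons (npair 1 y) (list_encode h)) y (v + 2 + hbits h) (2 + hweight h)"
      unfolding P_def h(2) by auto
    then show ?case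
    proof cases
      case app
      then show ?thesis
        using h(1) by (intro exI[of _ "npair 0 e # h"] exI[of _ y]) (simp add: run_app)
    next
      case read
      then show ?thesis
        using h(1) run_read[of h y] by (intro exI[of _ "npair 1 y # h"] exI[of _ y]) simp
    qed
  qed
  have complete: "P\<^sup>*\<^sup>* (?st 0 0 0 0) (?st (list_encode h) v (hbits h) (hweight h))" if "run h v" for h v
    using that
  proof induction
    case (run_app h v e y)
    then have "P (?st (list_encode h) v (hbits h) (hweight h))
      (?st (list_encode (npair 0 e # h)) y (hbits (npair 0 e # h)) (hweight (npair 0 e # h)))"
      unfolding P_def by auto
    with run_app.IH show ?case by (rule rtranclp.rtrancl_into_rtrancl)
  next
    case (run_read h y)
    then have "P (?st (list_encode h) (slen y) (hbits h) (hweight h))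
      (?st (list_encode (npair 1 y # h)) y (hbits (npair 1 y # h)) (hweight (npair 1 y # h)))"
      unfolding P_def by auto
    with run_read.IH show ?case by (rule rtranclp.rtrancl_into_rtrancl)
  qed simp
  have "run_code c v p w \<longleftrightarrow> P\<^sup>*\<^sup>* (?st 0 0 0 0) (?st c v p w)" for c v p w
  proof
    assume "run_code c v p w"
    then show "P\<^sup>*\<^sup>* (?st 0 0 0 0) (?st c v p w)"
      using complete[of "list_decode c" v] by (auto simp: run_code_def)
  next
    assume "P\<^sup>*\<^sup>* (?st 0 0 0 0) (?st c v p w)"
    then show "run_code c v p w" using sound by (fastforce simp: run_code_def)
  qed
  then show ?thesis
    by (simp only:) (intro re_rtranclp' P cf_intros assms)
qed

lemma re_light [re_intros]:
  assumes "cf f" "cf g"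
  shows "re (\<lambda>x. light (f x) (g x))"
proof -
  have "light k x \<longleftrightarrow> (\<exists>c p w. run_code c x p w \<and> w < k)" for k x
    unfolding light_def run_code_def by (metis list_encode_inverse)
  then have "re (\<lambda>z. light (pfst z) (psnd z))"
    by (simp only:) (intro re_intros cf_intros)
  from re_comp[OF this cf_npair[OF assms]] show ?thesis by simp
qed

lemma re_heavy [re_intros]:
  assumes "cf f1" "cf f2" "cf f3"
  shows "re (\<lambda>x. heavy (f1 x) (f2 x) (f3 x))"
proof -
  let ?st = "\<lambda>k x N b M. npair k (npair x (npair N (npair b M)))"
  \<comment> \<open>History codes are collected in increasing order: \<open>b\<close> bounds the
    next one from below, so none is counted twice. \<open>N\<close> is a guessed bound on the costs,
    and \<open>M\<close> accumulates the mass times \<open>2 ^ N\<close>, an integer.\<close>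
  define P where "P s s' \<longleftrightarrow> (\<exists>k x N b M c p w. s = ?st k x N b M \<and> b \<le> c \<and> run_code c x p w \<and>
      k \<le> w \<and> p + w \<le> N \<and> s' = ?st k x N (Suc c) (M + 2 ^ (N - (p + w))))" for s s'
  have P: "re (\<lambda>z. P (pfst z) (psnd z))"
    unfolding P_def by (intro re_intros cf_intros)
  define cost where "cost c = hbits (list_decode c) + hweight (list_decode c)" for c
  define good where "good k x N c \<longleftrightarrow> run (list_decode c) x \<and> k \<le> hweight (list_decode c) \<and> cost c \<le> N" for k x N c
  have P_iff: "P (?st k x N b M) s' \<longleftrightarrow>
      (\<exists>c. b \<le> c \<and> good k x N c \<and> s' = ?st k x N (Suc c) (M + 2 ^ (N - cost c)))" for k x N b M s'
    unfolding P_def run_code_def good_def cost_def by auto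
  have sound: "\<exists>b M C. s = ?st k x N b M \<and> finite C \<and> C \<subseteq> {..<b} \<and> (\<forall>c\<in>C. good k x N c) \<and> M = (\<Sum>c\<in>C. 2 ^ (N - cost c))"
    if "P\<^sup>*\<^sup>* (?st k x N 0 0) s" for k x N s
    using that
  proof (induction rule: rtranclp_induct)
    case base
    show ?case by (intro exI[of _ 0] exI[of _ "{}"]) simp
  next
    case (step s s')
    then obtain b M C where s: "s = ?st k x N b M" "finite C" "C \<subseteq> {..<b}" "\<forall>c\<in>C. good k x N c"
      "M = (\<Sum>c\<in>C. 2 ^ (N - cost c))" by blast
    obtain c where c: "b \<le> c" "good k x N c" "s' = ?st k x N (Suc c) (M + 2 ^ (N - cost c))"
      using step.hyps(2) unfolding s(1) P_iff by blast
    have "c \<notin> C" using s(3) c(1) by auto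
    then have "M + 2 ^ (N - cost c) = (\<Sum>c\<in>insert c C. 2 ^ (N - cost c))"
      using s(2) by (simp add: s(5) add.commute)
    moreover have "insert c C \<subseteq> {..<Suc c}" using s(3) c(1) by auto
    moreover have "\<forall>c\<in>insert c C. good k x N c" using s(4) c(2) by blast
    ultimately show ?case using c(3) s(2) by blast
  qed
  have complete: "finite C \<Longrightarrow> (\<forall>c\<in>C. good k x N c) \<Longrightarrow>
      \<exists>b. P\<^sup>*\<^sup>* (?st k x N 0 0) (?st k x N b (\<Sum>c\<in>C. 2 ^ (N - cost c))) \<and> (\<forall>c. (\<forall>c'\<in>C. c' < c) \<longrightarrow> b \<le> c)" for C k x N
  proof (induction C rule: finite_linorder_max_induct)
    case empty
    then show ?case by (intro exI[of _ 0]) simp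
  next
    case (insert c A)
    then obtain b where b: "P\<^sup>*\<^sup>* (?st k x N 0 0) (?st k x N b (\<Sum>c\<in>A. 2 ^ (N - cost c)))" "b \<le> c" by blast
    have "P (?st k x N b (\<Sum>c\<in>A. 2 ^ (N - cost c))) (?st k x N (Suc c) ((\<Sum>c\<in>A. 2 ^ (N - cost c)) + 2 ^ (N - cost c)))"
      unfolding P_iff using b(2) insert.prems by blast
    with b(1) have "P\<^sup>*\<^sup>* (?st k x N 0 0) (?st k x N (Suc c) ((\<Sum>c\<in>A. 2 ^ (N - cost c)) + 2 ^ (N - cost c)))"
      by (rule rtranclp.rtrancl_into_rtrancl)
    moreover have "c \<notin> A" using insert.hyps by blast
    ultimately show ?case
      using insert.hyps(1) by (intro exI[of _ "Suc c"]) (simp add: add.commute Suc_le_eq)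
  qed
  have nat_real: "2 ^ N \<le> M * 2 ^ l \<longleftrightarrow> (2::real) ^ N \<le> real M * 2 ^ l" for N M l
    using of_nat_le_iff[of "2 ^ N" "M * 2 ^ l", where 'a = real] by simp
  have scale: "(1/2) ^ l \<le> mass (list_decode ` C) \<longleftrightarrow> 2 ^ N \<le> (\<Sum>c\<in>C. 2 ^ (N - cost c)) * (2::nat) ^ l"
    if "\<And>c. c \<in> C \<Longrightarrow> cost c \<le> N" for C N l
  proof -
    have mass: "mass (list_decode ` C) = (\<Sum>c\<in>C. (1/2) ^ cost c)"
      unfolding mass_def by (subst sum.reindex) (auto simp: cost_def intro: inj_on_subset[OF inj_list_decode])
    have "(2::real) ^ (N - cost c) = 2 ^ N * (1/2) ^ cost c" if "c \<in> C" for c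
      using \<open>\<And>c. c \<in> C \<Longrightarrow> cost c \<le> N\<close>[OF that] by (simp add: power_diff power_one_over)
    then have "(\<Sum>c\<in>C. (2::real) ^ (N - cost c)) = (\<Sum>c\<in>C. 2 ^ N * (1/2) ^ cost c)"
      by (intro sum.cong refl)
    then have m: "real (\<Sum>c\<in>C. 2 ^ (N - cost c)) = 2 ^ N * mass (list_decode ` C)"
      unfolding mass of_nat_sum of_nat_power of_nat_numeral sum_distrib_left .
    have "2 ^ N \<le> (\<Sum>c\<in>C. 2 ^ (N - cost c)) * (2::nat) ^ l \<longleftrightarrow>
        (2::real) ^ N \<le> real (\<Sum>c\<in>C. 2 ^ (N - cost c)) * 2 ^ l"
      by (rule nat_real)
    also have "\<dots> \<longleftrightarrow> (2::real) ^ N * 1 \<le> 2 ^ N * (mass (list_decode ` C) * 2 ^ l)"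
      unfolding m by (simp add: mult.assoc)
    also have "\<dots> \<longleftrightarrow> 1 \<le> mass (list_decode ` C) * 2 ^ l"
      by (rule mult_le_cancel_left_pos) simp
    also have "\<dots> \<longleftrightarrow> (1/2) ^ l \<le> mass (list_decode ` C)"
      by (simp add: power_one_over field_simps)
    finally show ?thesis by simp
  qed
  have "heavy k x l \<longleftrightarrow>
      (\<exists>N b M. P\<^sup>*\<^sup>* (?st k x N 0 0) (?st k x N b M) \<and> 2 ^ N \<le> M * 2 ^ l)" for k x l
  proof
    assume "heavy k x l"
    then obtain H where H: "finite H" "\<forall>h\<in>H. run h x \<and> k \<le> hweight h" "(1/2) ^ l \<le> mass H"
      unfolding heavy_def by blast
    define C where "C = list_encode ` H"
    define N where "N = Max (insert 0 (cost ` C))"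
    have HC: "H = list_decode ` C" unfolding C_def image_image by simp
    have "finite C" using H(1) by (simp add: C_def)
    then have N: "cost c \<le> N" if "c \<in> C" for c unfolding N_def using that by (intro Max_ge) auto
    then have "\<forall>c\<in>C. good k x N c" using H(2) unfolding HC good_def by blast
    then obtain b where "P\<^sup>*\<^sup>* (?st k x N 0 0) (?st k x N b (\<Sum>c\<in>C. 2 ^ (N - cost c)))"
      using complete[OF \<open>finite C\<close>] by blast
    moreover have "2 ^ N \<le> (\<Sum>c\<in>C. 2 ^ (N - cost c)) * (2::nat) ^ l"
      using H(3) unfolding HC using scale[of C N l] N by blast
    ultimately show "\<exists>N b M. P\<^sup>*\<^sup>* (?st k x N 0 0) (?st k x N b M) \<and> 2 ^ N \<le> M * 2 ^ l" by blast
  next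
    assume "\<exists>N b M. P\<^sup>*\<^sup>* (?st k x N 0 0) (?st k x N b M) \<and> 2 ^ N \<le> M * 2 ^ l"
    then obtain N b M where M: "P\<^sup>*\<^sup>* (?st k x N 0 0) (?st k x N b M)" "2 ^ N \<le> M * 2 ^ l" by blast
    obtain C where C: "finite C" "\<forall>c\<in>C. good k x N c" "M = (\<Sum>c\<in>C. 2 ^ (N - cost c))"
      using sound[OF M(1)] by auto
    then have "(1/2) ^ l \<le> mass (list_decode ` C)"
      using scale[of C N l] M(2) by (auto simp: good_def)
    then show "heavy k x l"
      unfolding heavy_def using C(1,2) by (intro exI[of _ "list_decode ` C"]) (auto simp: good_def)
  qed
  then have "re (\<lambda>z. heavy (pfst z) (pfst (psnd z)) (psnd (psnd z)))"
    by (simp only:) (intro re_intros re_rtranclp' P cf_intros)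
  from re_comp[OF this cf_npair[OF assms(1) cf_npair[OF assms(2,3)]]] show ?thesis by simp
qed

section \<open>The separating machine\<close>

text \<open>The \<open>i\<close>-th code word for the constant \<open>d\<close> is \<open>t\<close> with \<open>length t = l\<close> and \<open>strval t = m\<close>. Code words
  are taken from left to right, and the guard stops when those of length \<open>l\<close> are exhausted; \<open>F\<close> answers
  the question \<open>npair d (npair i l)\<close> with 1 if the length is to be increased, and with 0 otherwise.\<close>
inductive allocation :: "(nat \<Rightarrow> nat \<Rightarrow> bool) \<Rightarrow> nat \<Rightarrow> nat \<Rightarrow> nat \<Rightarrow> nat \<Rightarrow> bool" for F d where
  allocation_0: "allocation F d 0 8 3"
| allocation_Suc: "allocation F d i m l \<Longrightarrow> Suc m < 2 ^ Suc l \<Longrightarrow> F (npair d (npair i l)) b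
    \<Longrightarrow> allocation F d (Suc i) (Suc m * 2 ^ b) (l + b)"

lemma re_allocation:
  assumes "re (\<lambda>z. F (pfst z) (psnd z))" "cf f1" "cf f2" "cf f3" "cf f4"
  shows "re (\<lambda>x. allocation F (f1 x) (f2 x) (f3 x) (f4 x))"
proof -
  let ?st = "\<lambda>d i m l. npair d (npair i (npair m l))"
  define P where "P s s' \<longleftrightarrow> (\<exists>d i m l b. s = ?st d i m l \<and> Suc m < 2 ^ Suc l \<and> F (npair d (npair i l)) b
      \<and> s' = ?st d (Suc i) (Suc m * 2 ^ b) (l + b))" for s s'
  have F: "re (\<lambda>x. F (f x) (g x))" if "cf f" "cf g" for f g
    using re_comp[OF assms(1) cf_npair[OF that]] by simp
  have P: "re (\<lambda>z. P (pfst z) (psnd z))"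
    unfolding P_def by (intro re_intros F cf_intros)
  have sound: "\<exists>i m l. s = ?st d i m l \<and> allocation F d i m l" if "P\<^sup>*\<^sup>* (?st d 0 8 3) s" for d s
    using that
  proof (induction rule: rtranclp_induct)
    case base
    show ?case using allocation_0 by blast
  next
    case (step s s')
    then show ?case unfolding P_def using allocation_Suc by fastforce
  qed
  have complete: "P\<^sup>*\<^sup>* (?st d 0 8 3) (?st d i m l)" if "allocation F d i m l" for d i m l
    using that
  proof induction
    case (allocation_Suc i m l b)
    then have "P (?st d i m l) (?st d (Suc i) (Suc m * 2 ^ b) (l + b))"
      unfolding P_def by blast
    with allocation_Suc.IH show ?case by (rule rtranclp.rtrancl_into_rtrancl)
  qed simp
  have "allocation F d i m l \<longleftrightarrow> P\<^sup>*\<^sup>* (?st d 0 8 3) (?st d i m l)" for d i m l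
  proof
    assume "P\<^sup>*\<^sup>* (?st d 0 8 3) (?st d i m l)"
    then show "allocation F d i m l" using sound by fastforce
  qed (rule complete)
  then show ?thesis
    by (simp only:) (intro re_rtranclp' P cf_intros assms)
qed

text \<open>The machine is computable and prefix-free for any enumerable single-valued
  \<open>F\<close>; the strategy is fixed only in \<open>separating_machine\<close>.\<close>

locale selection =
  fixes F :: "nat \<Rightarrow> nat \<Rightarrow> bool"
  assumes F_functional: "F q b \<Longrightarrow> F q b' \<Longrightarrow> b = b'"
    and re_F: "re (\<lambda>z. F (pfst z) (psnd z))"
begin

lemma allocation_functional:
  "allocation F d i m l \<Longrightarrow> allocation F d i m' l' \<Longrightarrow> m = m' \<and> l = l'"
proof (induction arbitrary: m' l' rule: allocation.induct)
  case allocation_0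
  then show ?case by (auto elim: allocation.cases)
next
  case (allocation_Suc i m l b)
  from allocation_Suc.prems obtain m0 l0 b0 where
    *: "allocation F d i m0 l0" "F (npair d (npair i l0)) b0" "m' = Suc m0 * 2 ^ b0" "l' = l0 + b0"
    by (auto elim: allocation.cases)
  then have "m = m0" "l = l0" using allocation_Suc.IH by auto
  moreover from this have "b = b0" using *(2) allocation_Suc.hyps(3) F_functional by blast
  ultimately show ?case using * by simp
qed

lemma allocation_range: "allocation F d i m l \<Longrightarrow> 2 ^ l \<le> m \<and> m < 2 ^ Suc l"
proof (induction rule: allocation.induct)
  case (allocation_Suc i m l b)
  have "2 ^ l * 2 ^ b \<le> Suc m * 2 ^ b" "Suc m * 2 ^ b < 2 ^ Suc l * 2 ^ b"
    by (rule mult_right_mono, use allocation_Suc in simp, simp)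
       (rule mult_strict_right_mono, use allocation_Suc in simp_all)
  then show ?case by (simp add: power_add)
qed simp

lemma allocation_strval:
  assumes "allocation F d i m l"
  obtains t where "strval t = m" "length t = l"
proof
  have range: "2 ^ l \<le> m" "m < 2 ^ Suc l" using allocation_range[OF assms] by auto
  have "0 < (2::nat) ^ l" by simp
  then have "m > 0" using range(1) by linarith
  then show st: "strval (bits m) = m" by (rule strval_bits)
  then have "(2::nat) ^ length (bits m) < 2 ^ Suc l" "(2::nat) ^ l < 2 ^ Suc (length (bits m))"
    using range strval_ge[of "bits m"] strval_less[of "bits m"] by linarith+
  then show "length (bits m) = l"
    using power_less_imp_less_exp[of "2::nat" "length (bits m)" "Suc l"]
      power_less_imp_less_exp[of "2::nat" l "Suc (length (bits m))"] by linarith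
qed

text \<open>The extensions of a word by \<open>l' - l\<close> bits have values below
  \<open>Suc m * 2 ^ (l' - l)\<close>; later words lie to the right of all of them.\<close>

lemma allocation_separated:
  assumes "allocation F d j m' l'" "allocation F d i m l" "i < j"
  shows "l \<le> l' \<and> Suc m * 2 ^ (l' - l) \<le> m'"
  using assms
proof (induction rule: allocation.induct)
  case (allocation_Suc j m' l' b)
  show ?case
  proof (cases "i = j")
    case True
    then have "m = m'" "l = l'" using allocation_functional allocation_Suc by blast+
    then show ?thesis by simp
  next
    case False
    then have IH: "l \<le> l'" "Suc m * 2 ^ (l' - l) \<le> m'" using allocation_Suc by auto
    have "Suc m * 2 ^ (l' + b - l) = Suc m * 2 ^ (l' - l) * 2 ^ b"
      using IH(1) by (simp only: mult.assoc power_add[symmetric]) simp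
    also have "\<dots> \<le> Suc m' * 2 ^ b" using IH(2) by (intro mult_right_mono) simp_all
    finally show ?thesis using IH(1) by simp
  qed
qed simp

text \<open>The prefix \<open>1\<^sup>d0\<close> keeps the code words for different constants apart.\<close>
definition codeword :: "str \<Rightarrow> nat \<Rightarrow> bool" where
  "codeword s i \<longleftrightarrow> (\<exists>d t. s = replicate d True @ False # t \<and> allocation F d i (strval t) (length t))"

lemma replicate_eq_iff:
  "replicate d True @ False # t = replicate d' True @ False # t' \<longleftrightarrow> d = d' \<and> t = t'"
proof (induction d arbitrary: d')
  case 0
  then show ?case by (cases d') auto
next
  case (Suc d)
  then show ?case by (cases d') auto
qed

text \<open>Gives prefix-freeness and single-valuedness at once. An extension of a word has too
  small a value to be a later word. Conversely a later word is not shorter, so as a prefix of an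
  earlier one it would equal it, against the order of the values.\<close>

lemma codeword_prefix:
  assumes "codeword y i" "codeword z j" "z = y @ w"
  shows "w = [] \<and> i = j"
proof -
  obtain d t where y: "y = replicate d True @ False # t" "allocation F d i (strval t) (length t)"
    using assms(1) unfolding codeword_def by blast
  obtain d' t' where z: "z = replicate d' True @ False # t'" "allocation F d' j (strval t') (length t')"
    using assms(2) unfolding codeword_def by blast
  have "replicate d' True @ False # t' = replicate d True @ False # (t @ w)"
    using assms(3) y(1) z(1) by simp
  then have d: "d' = d" and t': "t' = t @ w" unfolding replicate_eq_iff by auto
  have "strval t' + 2 ^ length w = strval t * 2 ^ length w + strval w"
    unfolding t' by (rule strval_append)
  then have less: "strval t' < Suc (strval t) * 2 ^ length w"
    using strval_less[of w] by simp
  show ?thesis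
  proof (rule linorder_cases[of i j])
    assume "i < j"
    then have "Suc (strval t) * 2 ^ (length t' - length t) \<le> strval t'"
      using allocation_separated[OF z(2)[unfolded d] y(2)] by simp
    then show ?thesis using less by (simp add: t')
  next
    assume "i = j"
    then have "length t = length t'" using allocation_functional y(2) z(2)[unfolded d] by blast
    then show ?thesis using \<open>i = j\<close> by (simp add: t')
  next
    assume "j < i"
    then have *: "length t' \<le> length t" "Suc (strval t') * 2 ^ (length t - length t') \<le> strval t"
      using allocation_separated[OF y(2) z(2)[unfolded d]] by simp_all
    then have "w = []" by (simp add: t')
    then show ?thesis using * by (simp add: t')
  qed
qed

lemma codeword_functional: "codeword s i \<Longrightarrow> codeword s j \<Longrightarrow> i = j"
  using codeword_prefix[of s i s j "[]"] by simp

text \<open>The prefix has value \<open>2 ^ (d + 2) - 2\<close>, and the leading 1 of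
  \<open>t\<close> is dropped; the resulting 3 is added on the left to avoid subtraction.\<close>

lemma strval_prefix: "strval (replicate d True @ False # t) + 3 * 2 ^ length t = 2 ^ (d + 2) * 2 ^ length t + strval t"
proof -
  have r: "Suc (strval (replicate d True)) = 2 ^ Suc d"
    by (induction d) (simp_all add: replicate_append_same[symmetric])
  have "strval (replicate d True @ [False]) + 2 = 2 ^ (d + 2)"
    using r by simp
  then have "(strval (replicate d True @ [False]) + 2) * 2 ^ length t = 2 ^ (d + 2) * 2 ^ length t" by simp
  then show ?thesis
    using strval_append[of "replicate d True @ [False]" t] by (simp add: algebra_simps)
qed

text \<open>Replaces strings by arithmetic, in which code words are seen to be enumerable.\<close>

lemma codeword_iff:
  "codeword (str_of_nat n) i \<longleftrightarrow>
    (\<exists>d m l. allocation F d i m l \<and> Suc n + 3 * 2 ^ l = 2 ^ (d + 2) * 2 ^ l + m)"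
proof
  assume "codeword (str_of_nat n) i"
  then obtain d t where t: "str_of_nat n = replicate d True @ False # t" "allocation F d i (strval t) (length t)"
    unfolding codeword_def by blast
  have "strval (str_of_nat n) = Suc n" by (simp add: str_of_nat_def strval_bits)
  then show "\<exists>d m l. allocation F d i m l \<and> Suc n + 3 * 2 ^ l = 2 ^ (d + 2) * 2 ^ l + m"
    using t strval_prefix[of d t] by (intro exI[of _ d] exI[of _ "strval t"] exI[of _ "length t"]) simp
next
  assume "\<exists>d m l. allocation F d i m l \<and> Suc n + 3 * 2 ^ l = 2 ^ (d + 2) * 2 ^ l + m"
  then obtain d m l where m: "allocation F d i m l" "Suc n + 3 * 2 ^ l = 2 ^ (d + 2) * 2 ^ l + m" by blast
  obtain t where st: "strval t = m" and lt: "length t = l"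
    using allocation_strval[OF m(1)] .
  have "strval (replicate d True @ False # t) = Suc n"
    using strval_prefix[of d t] m(2) unfolding st lt by linarith
  then have "str_of_nat n = replicate d True @ False # t"
    using bits_strval by (metis Suc_eq_plus1 str_of_nat_def)
  then show "codeword (str_of_nat n) i"
    unfolding codeword_def using m(1) st lt by blast
qed

definition machine :: "str \<Rightarrow> str option" where
  "machine s = (if \<exists>i. codeword s i then Some (str_of_nat (THE i. codeword s i)) else None)"

lemma machine_eq: "machine s = Some x \<longleftrightarrow> codeword s (nat_of_str x)"
proof -
  have "(THE i. codeword s i) = i" if "codeword s i" for i
    using that codeword_functional by blast
  then show ?thesis
    unfolding machine_def by (auto dest: codeword_functional[of s "nat_of_str x"])
qed

lemma prefix_free_machine: "prefix_free_machine machine"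
  unfolding prefix_free_machine_def
proof (intro conjI allI impI)
  have "map_option nat_of_str (machine s) = Some i \<longleftrightarrow> codeword s i" for s i
    using machine_eq[of s "str_of_nat i"] by auto
  then have "(\<lambda>z. map_option nat_of_str (machine (str_of_nat (pfst z))) = Some (psnd z)) =
      (\<lambda>z. \<exists>d m l. allocation F d (psnd z) m l \<and> Suc (pfst z) + 3 * 2 ^ l = 2 ^ (d + 2) * 2 ^ l + m)"
    by (simp only: codeword_iff)
  moreover have "re (\<lambda>z. \<exists>d m l. allocation F d (psnd z) m l \<and> Suc (pfst z) + 3 * 2 ^ l = 2 ^ (d + 2) * 2 ^ l + m)"
    by (intro re_intros re_allocation re_F cf_intros)
  ultimately show "pc_str machine"
    unfolding pc_str_def by (intro partial_computableI) simp
  fix y z w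
  assume "machine y \<noteq> None" "machine z \<noteq> None" "z = y @ w"
  then obtain i j where "codeword y i" "codeword z j" unfolding machine_def by (auto split: if_splits)
  then show "y = z" using codeword_prefix \<open>z = y @ w\<close> by fastforce
qed

end


lemma separating_machine:
  obtains T where "prefix_free_machine T"
    "\<And>c. \<exists>s x. T s = Some x \<and> length s + c < cplx (nat_of_str x)"
proof -
  \<comment> \<open>A code word has length \<open>l + d + 1\<close>, so \<open>l + 2 * d + 1\<close>
    is the largest complexity within \<open>d\<close> of it. The threshold \<open>2 * d + 4\<close>
    is chosen so that the words answered with 0 have measure at most 1/4.\<close>
  define R where "R q b \<longleftrightarrow> b = 1 \<and> light (2 * pfst q + 4) (pfst (psnd q)) \<or>
    b = 0 \<and> heavy (2 * pfst q + 4) (pfst (psnd q)) (psnd (psnd q) + 2 * pfst q + 1)" for q b :: nat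
  have "re (\<lambda>z. R (pfst z) (psnd z))"
    unfolding R_def by (intro re_intros cf_intros)
  then obtain F where F: "re (\<lambda>z. F (pfst z) (psnd z))" "\<And>q b. F q b \<Longrightarrow> R q b"
    "\<And>q b b'. F q b \<Longrightarrow> F q b' \<Longrightarrow> b = b'" "\<And>q b. R q b \<Longrightarrow> \<exists>b. F q b"
    by (rule re_uniformize) blast
  interpret selection F
    by unfold_locales (use F in blast)+
  have "\<exists>s i. codeword s i \<and> length s + d < cplx i" for d
  \<comment> \<open>Otherwise every question is answered, so the allocation never stops, while the
    lengths of its words stay bounded.\<close>
  proof (rule ccontr)
    assume no: "\<nexists>s i. codeword s i \<and> length s + d < cplx i"
    define \<phi> where "\<phi> q = (THE b. F q b)" for q
    have \<phi>: "\<phi> q = b" if "F q b" for q b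
      unfolding \<phi>_def using that F(3) by blast
    \<comment> \<open>Total recursions that follow \<open>allocation\<close> as long as
      \<open>F\<close> answers; without an answer the values are arbitrary.\<close>
    define l where "l = rec_nat 3 (\<lambda>i a. a + \<phi> (npair d (npair i a)))"
    define b where "b i = \<phi> (npair d (npair i (l i)))" for i
    define m where "m = rec_nat 8 (\<lambda>i a. Suc a * 2 ^ b i)"
    have l_simps: "l 0 = 3" "l (Suc i) = l i + b i" for i by (simp_all add: l_def b_def)
    have m_simps: "m 0 = 8" "m (Suc i) = Suc (m i) * 2 ^ b i" for i by (simp_all add: m_def)
    define used where "used n = (\<Sum>i<n. (1/2::real) ^ l i)" for n
    \<comment> \<open>With strings as dyadic intervals, \<open>m n / 2 ^ l n - 1\<close> is the left
      end of the next word. It equals the measure of the earlier words because nothing is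
      skipped.\<close>
    have m_eq: "real (m n) = 2 ^ l n * (1 + used n)" for n
    proof (induction n)
      case (Suc n)
      have "(2::real) ^ l n * (1/2) ^ l n = 1" by (simp add: power_one_over)
      then have "2 ^ l n * (1 + used (Suc n)) = real (m n) + 1"
        by (simp only: used_def sum.lessThan_Suc Suc.IH[unfolded used_def]) (simp add: algebra_simps)
      then have "real (m (Suc n)) = 2 ^ l n * (1 + used (Suc n)) * 2 ^ b n"
        by (simp add: m_simps algebra_simps)
      then show ?case by (simp add: l_simps power_add)
    qed (simp add: m_simps l_simps used_def)
    let ?k = "2 * d + 4"
    define sel where "sel n \<longleftrightarrow> F (npair d (npair n (l n))) (b n)" for n
    have sel_R: "b n = 1 \<and> light ?k n \<or> b n = 0 \<and> heavy ?k n (l n + 2 * d + 1)" if "sel n" for n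
      using F(2)[OF that[unfolded sel_def]] by (simp add: R_def)
    have used_le: "used n \<le> 1/2" if "\<And>i. i < n \<Longrightarrow> sel i" for n
    proof -
      define I where "I = {i. i < n \<and> b i = 1}"
      define J where "J = {i. i < n \<and> b i = 0}"
      have n: "{..<n} = I \<union> J" "I \<inter> J = {}" "finite I" "finite J"
      proof -
        have "b i = 1 \<or> b i = 0" if "i < n" for i
          using sel_R[OF \<open>\<And>i. i < n \<Longrightarrow> sel i\<close>[OF that]] by auto
        then show "{..<n} = I \<union> J" unfolding I_def J_def by blast
      qed (auto simp: I_def J_def)
      \<comment> \<open>A word answered with 1 is paid for by the halving of
        \<open>2 * (1/2) ^ l\<close>; the initial length 3 makes the budget 1/4.\<close>
      have I: "(\<Sum>i\<in>{i. i < n' \<and> b i = 1}. (1/2::real) ^ l i) + 2 * (1/2) ^ l n' \<le> 1/4" if "n' \<le> n" for n'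
        using that
      proof (induction n')
        case 0
        then show ?case by (simp add: l_simps power3_eq_cube)
      next
        case (Suc n')
        then consider "b n' = 1" | "b n' = 0" using sel_R[OF \<open>\<And>i. i < n \<Longrightarrow> sel i\<close>, of n'] Suc.prems
            by (meson Suc_le_lessD)
        then show ?case
        proof cases
          case 1
          then have "{i. i < Suc n' \<and> b i = 1} = insert n' {i. i < n' \<and> b i = 1}"
            by (auto simp: less_Suc_eq)
          then show ?thesis using Suc 1 by (simp add: l_simps)
        next
          case 2
          then have "{i. i < Suc n' \<and> b i = 1} = {i. i < n' \<and> b i = 1}"
            by (auto simp: less_Suc_eq)
          then show ?thesis using Suc 2 by (simp add: l_simps)
        qed
      qed
      have "(0::real) \<le> 2 * (1/2) ^ l n" by simp
      then have "(\<Sum>i\<in>I. (1/2::real) ^ l i) \<le> 1/4" using I[of n] unfolding I_def by linarith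
      \<comment> \<open>Each answer 0 exhibits mass \<open>(1/2) ^ (l i + 2 * d + 1)\<close> of
        expensive histories at a new number, and these have total mass at most
        \<open>2 * (1/2) ^ (2 * d + 4)\<close>.\<close>
      moreover have "(\<Sum>i\<in>J. (1/2::real) ^ l i) \<le> 1/4"
      proof -
        have "(\<Sum>i\<in>J. (1/2::real) ^ (l i + 2 * d + 1)) \<le> 2 * (1/2) ^ ?k"
        proof (rule sum_heavy_bound[OF n(4)])
          fix i assume "i \<in> J"
          then show "heavy ?k i (l i + 2 * d + 1)" using sel_R[OF that, of i] by (auto simp: J_def)
        qed
        moreover have "(1/2::real) ^ (l i + 2 * d + 1) = (1/2) ^ l i * (1/2) ^ (2 * d + 1)" for i
          by (simp only: power_add mult.assoc)
        moreover have "2 * (1/2::real) ^ ?k = 1/4 * (1/2) ^ (2 * d + 1)"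
          by (simp only: power_add) (simp add: power_divide)
        ultimately have "(\<Sum>i\<in>J. (1/2::real) ^ l i) * (1/2) ^ (2 * d + 1) \<le> 1/4 * (1/2) ^ (2 * d + 1)"
          by (simp only: sum_distrib_right)
        then show ?thesis by (rule mult_right_le_imp_le) simp
      qed
      ultimately show ?thesis
        unfolding used_def n(1) using n(2-4) by (simp add: sum.union_disjoint)
    qed
    have "allocation F d n (m n) (l n) \<and> (\<forall>i<n. sel i)" for n
    proof (induction n)
      case 0
      then show ?case by (simp add: l_simps m_simps allocation_0)
    next
      case (Suc n)
      obtain t where t: "strval t = m n" "length t = l n"
        using allocation_strval Suc.IH by blast
      then have "codeword (replicate d True @ False # t) n"
        unfolding codeword_def using Suc.IH by metis
      then have "cplx n \<le> l n + 2 * d + 1" using no t(2) by fastforce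
      then have "heavy 0 n (l n + 2 * d + 1)" by (simp add: cplx_le_iff)
      \<comment> \<open>Either one of the histories witnessing the complexity is cheap, or all of
        them are expensive and keep the full mass.\<close>
      then have "light ?k n \<or> heavy ?k n (l n + 2 * d + 1)"
        unfolding light_def heavy_def by (meson not_le)
      then have "\<exists>b. R (npair d (npair n (l n))) b" unfolding R_def by auto
      then have "sel n" unfolding sel_def b_def using F(4) \<phi> by metis
      then have sel: "\<forall>i<Suc n. sel i" using Suc.IH less_Suc_eq by auto
      \<comment> \<open>At most half of the measure is used, so the words of the current length are
        not exhausted.\<close>
      then have "used (Suc n) \<le> 1/2" by (intro used_le) auto
      then have "2 ^ l n * (1 + used (Suc n)) \<le> (2::real) ^ l n * (3/2)" by (intro mult_left_mono) auto
      moreover have "2 ^ l n * (1 + used (Suc n)) = real (Suc (m n))"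
        unfolding of_nat_Suc m_eq by (simp add: used_def algebra_simps power_one_over)
      ultimately have "real (Suc (m n)) < real (2 ^ Suc (l n))"
        by (simp add: less_le_trans[of _ "2 ^ l n * (3/2)"])
      then have "Suc (m n) < 2 ^ Suc (l n)" by (simp only: of_nat_less_iff)
      then have "allocation F d (Suc n) (m (Suc n)) (l (Suc n))"
        using Suc.IH \<open>sel n\<close> unfolding l_simps m_simps sel_def by (intro allocation_Suc) auto
      then show ?case using sel by blast
    qed
    then have all: "sel n" for n by blast
    have "finite {x. light ?k x}"
    proof -
      have "{x. light ?k x} = (\<lambda>h. THE v. run h v) ` {h. (\<exists>v. run h v) \<and> hweight h < ?k}"
      proof -
        have "(THE v. run h v) = v" if "run h v" for h v using that run_functional by blast
        then show ?thesis unfolding light_def by (auto simp: image_iff)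
      qed
      then show ?thesis using finite_light by simp
    qed
    moreover have "light ?k i" if "b i = 1" for i
      using sel_R[OF all, of i] that by auto
    ultimately have fin: "finite {i. b i = 1}"
      by (auto intro: rev_finite_subset)
    \<comment> \<open>The length grows by one at light numbers only, so \<open>B\<close> bounds all
      lengths, and \<open>2 ^ B\<close> words already use measure at least 1.\<close>
    define B where "B = 3 + card {i. b i = 1}"
    have "l n = 3 + card {i. i < n \<and> b i = 1}" for n
    proof (induction n)
      case (Suc n)
      have "{i. i < Suc n \<and> b i = 1} = (if b n = 1 then insert n {i. i < n \<and> b i = 1} else {i. i < n \<and> b i = 1})"
        by (auto simp: less_Suc_eq)
      then show ?case using Suc sel_R[OF all, of n] by (auto simp: l_simps)
    qed (simp add: l_simps)
    then have l_le: "l n \<le> B" for n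
      unfolding B_def using card_mono[OF fin, of "{i. i < n \<and> b i = 1}"] by auto
    have "real n * (1/2) ^ B \<le> used n" for n
    proof -
      have "(\<Sum>i<n. (1/2::real) ^ B) \<le> used n"
        unfolding used_def using l_le by (intro sum_mono power_decreasing) auto
      then show ?thesis by simp
    qed
    from this[of "2 ^ B"] have "1 \<le> used (2 ^ B)" by (simp add: power_one_over)
    then show False using used_le[of "2 ^ B"] all by fastforce
  qed
  then have "\<exists>s x. machine s = Some x \<and> length s + c < cplx (nat_of_str x)" for c
    by (metis machine_eq nat_of_str_of_nat)
  then show thesis using that prefix_free_machine by blast
qed

section \<open>The theorem\<close>

theorem theorem3:
  shows "\<exists>A :: str \<Rightarrow> nat.
    upper_semicomputable A
  \<and> (\<forall>f. pc_str f \<longrightarrow> (\<exists>c::nat. \<forall>x y. f x = Some y \<longrightarrow> A y \<le> A x + c))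
  \<and> (\<lambda>x. (1/2::real) ^ A x) summable_on UNIV
  \<and> (\<exists>c::nat. \<forall>x. A x \<le> length x + A (str_of_nat (length x)) + c)
  \<and> (\<exists>c'::real. \<forall>n b :: nat.
        real (card {x :: str. length x = n \<and>
                     int (A x) \<le> int n + int (A (str_of_nat n)) - int b})
        \<le> c' * 2 powr (real n - real b))
  \<and> (\<forall>U. optimal_pf_machine U \<longrightarrow>
        (\<forall>m::nat. \<exists>x. enat (A x) + enat m < C_mach U x \<or> C_mach U x + enat m < enat (A x)))"
proof (intro exI[of _ "\<lambda>x. cplx (nat_of_str x)"] conjI allI impI)
  show "upper_semicomputable (\<lambda>x. cplx (nat_of_str x))"
    unfolding upper_semicomputable_def nat_of_str_of_nat cplx_le_iff
    by (intro ce_pred2I re_intros cf_intros)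
next
  fix f assume "pc_str f"
  then obtain e where e: "\<And>n y. map_option nat_of_str (f (str_of_nat n)) = Some y \<longleftrightarrow> univ e n y"
    unfolding pc_str_def by (rule partial_computable_univ) blast
  have "cplx (nat_of_str y) \<le> cplx (nat_of_str x) + 2 * (e + 3)" if "f x = Some y" for x y
    using e[of "nat_of_str x" "nat_of_str y"] that by (intro cplx_app) simp
  then show "\<exists>c. \<forall>x y. f x = Some y \<longrightarrow> cplx (nat_of_str y) \<le> cplx (nat_of_str x) + c"
    by blast
next
  have "(\<Sum>x\<in>X. (1/2::real) ^ cplx (nat_of_str x)) \<le> 2" if "finite X" for X
  proof -
    have "(\<Sum>x\<in>X. (1/2::real) ^ cplx (nat_of_str x)) = (\<Sum>n\<in>nat_of_str ` X. (1/2) ^ cplx n)"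
      by (subst sum.reindex) (simp_all add: inj_on_def)
    also have "\<dots> \<le> 2 * (1/2) ^ 0"
      using that by (intro sum_heavy_bound[of _ 0]) (simp_all add: cplx_le_iff[symmetric])
    finally show ?thesis by simp
  qed
  then show "(\<lambda>x. (1/2::real) ^ cplx (nat_of_str x)) summable_on UNIV"
    by (intro nonneg_bdd_above_summable_on bdd_aboveI[where M = 2]) auto
next
  show "\<exists>c. \<forall>x. cplx (nat_of_str x) \<le> length x + cplx (nat_of_str (str_of_nat (length x))) + c"
  proof (intro exI[of _ 4] allI)
    fix x :: str
    show "cplx (nat_of_str x) \<le> length x + cplx (nat_of_str (str_of_nat (length x))) + 4"
      using cplx_read[of "nat_of_str x"] by simp
  qed
next
  obtain C :: real where C: "\<And>X n. finite X \<Longrightarrow> (\<And>x. x \<in> X \<Longrightarrow> slen x = n) \<Longrightarrow>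
      (\<Sum>x\<in>X. (1/2) ^ cplx x) \<le> C * (1/2) ^ cplx n"
    by (rule sum_cplx_slen) blast
  have "real (card {x :: str. length x = n \<and>
      int (cplx (nat_of_str x)) \<le> int n + int (cplx (nat_of_str (str_of_nat n))) - int b}) \<le> C * 2 powr (real n - real b)"
    (is "real (card ?X) \<le> _") for n b
  proof -
    have "finite {x :: str. set x \<subseteq> UNIV \<and> length x = n}" by (rule finite_lists_length_eq) simp
    then have fin: "finite ?X" by (rule rev_finite_subset) auto
    \<comment> \<open>Each counted string contributes at least \<open>?u\<close> to the sum bounded
      by \<open>sum_cplx_slen\<close>. The exponent can have either sign, hence
      \<open>powr\<close>.\<close>
    let ?u = "2 powr (real b - real n - real (cplx n))"
    have "real (card ?X) * ?u = (\<Sum>x\<in>?X. ?u)" by simp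
    also have "\<dots> \<le> (\<Sum>x\<in>?X. (1/2) ^ cplx (nat_of_str x))"
    proof (rule sum_mono)
      fix x assume "x \<in> ?X"
      then have "real_of_int (int (cplx (nat_of_str x))) \<le> real_of_int (int n + int (cplx n) - int b)"
        by (subst of_int_le_iff) simp
      then have "?u \<le> 2 powr (- real (cplx (nat_of_str x)))"
        by (intro powr_mono) simp_all
      then show "?u \<le> (1/2) ^ cplx (nat_of_str x)"
        by (simp add: powr_minus powr_realpow power_one_over inverse_eq_divide)
    qed
    also have "\<dots> = (\<Sum>k\<in>nat_of_str ` ?X. (1/2) ^ cplx k)"
      by (subst sum.reindex) (simp_all add: inj_on_def)
    also have "\<dots> \<le> C * (1/2) ^ cplx n"
      using fin by (intro C) auto
    also have "(1/2) ^ cplx n = 2 powr (real n - real b) * ?u"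
      by (simp add: powr_add[symmetric] powr_minus powr_realpow power_one_over inverse_eq_divide)
    finally have "real (card ?X) * ?u \<le> C * 2 powr (real n - real b) * ?u" by simp
    then show ?thesis by (rule mult_right_le_imp_le) simp
  qed
  then show "\<exists>c'::real. \<forall>n b. real (card {x :: str. length x = n \<and>
      int (cplx (nat_of_str x)) \<le> int n + int (cplx (nat_of_str (str_of_nat n))) - int b})
      \<le> c' * 2 powr (real n - real b)"
    by blast
next
  fix U and m :: nat
  assume U: "optimal_pf_machine U"
  obtain T where T: "prefix_free_machine T"
    "\<And>c. \<exists>s x. T s = Some x \<and> length s + c < cplx (nat_of_str x)"
    by (rule separating_machine) blast
  obtain c :: nat where c: "\<And>x. C_mach U x \<le> C_mach T x + enat c"
    using U T(1) unfolding optimal_pf_machine_def by blast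
  \<comment> \<open>The gap is \<open>c + m\<close> so that \<open>c\<close> absorbs the constant of
    optimality.\<close>
  obtain s x where s: "T s = Some x" "length s + (c + m) < cplx (nat_of_str x)"
    using T(2) by blast
  have "C_mach T x \<le> enat (length s)"
    unfolding C_mach_def using s(1) by (intro Inf_lower) simp
  then have "C_mach T x + enat c + enat m \<le> enat (length s) + enat c + enat m"
    by (intro add_right_mono)
  then have "C_mach U x + enat m \<le> enat (length s + c + m)"
    using c[of x] by (metis add_right_mono order_trans plus_enat_simps(1))
  also have "\<dots> < enat (cplx (nat_of_str x))" using s(2) by simp
  finally show "\<exists>x. enat (cplx (nat_of_str x)) + enat m < C_mach U x \<or>
      C_mach U x + enat m < enat (cplx (nat_of_str x))"
    by blast
qed

end
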